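(* Let $\mathcal{G}=(V,E)$ be a DAG and let $i,j\in V$ and $K\subseteq V$ be such that $K$ does not $d$-separate $i$ from $j$. For $\delta\in[0,1]$ let $\mathcal{M}_{i\perp_\delta j|K}$ denote the set of covariance matrices $\Sigma$ with $|\rho_{i,j\cdot K}|\le\delta$, and consider a node $l$ such that $K$ does not $d$-separate $i$ from $l$. Then $\mathcal{M}_\mathcal{G}\cap\mathcal{M}_{i\perp_\delta j|K}\subseteq\mathcal{M}_{i\perp_\delta l|K}$ for all $\delta\in[0,1]$ if and only if $\{j\}\cup K$ $d$-separates $i$ and $l$ in $\mathcal{G}$.
   Context: $\mathcal{M}_\mathcal{G}$ is the Gaussian DAG model: the set of matrices $(I-\Lambda)^{-T}\Omega(I-\Lambda)^{-1}$ with $\Lambda=(\lambda_{uv})$ real, $\lambda_{uv}=0$ unless $u\to v\in E$, and $\Omega$ positive diagonal. For a covariance matrix $\Sigma$, the conditional covariance is $\Sigma_{A,B\cdot C}=\Sigma_{A,B}-\Sigma_{A,C}\Sigma_{C,C}^{-1}\Sigma_{C,B}$ and the partial correlation is $\rho_{a,b\cdot C}=\sigma_{a,b\cdot C}/\sqrt{\sigma_{a,a\cdot C}\sigma_{b,b\cdot C}}$. $d$-separation: $C$ $d$-separates $a$ and $b$ if every path between them contains a non-collider in $C$ or a collider (node $k$ with $u\to k\leftarrow w$ on the path) that is not in $C$ and has no descendant in $C$. *)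

theory Defs
  imports "Jordan_Normal_Form.DL_Submatrix" "Jordan_Normal_Form.Gauss_Jordan_Elimination"
begin

text \<open>Vertices of the DAG are the natural numbers 0..n-1; a directed edge u -> v is (u,v) in E.\<close>

definition dag :: "nat \<Rightarrow> (nat \<times> nat) set \<Rightarrow> bool" where
  "dag n E \<longleftrightarrow> E \<subseteq> {..<n} \<times> {..<n} \<and> acyclic E"

definition adjacent :: "(nat \<times> nat) set \<Rightarrow> nat \<Rightarrow> nat \<Rightarrow> bool" where
  "adjacent E u w \<longleftrightarrow> (u, w) \<in> E \<or> (w, u) \<in> E"

definition is_path :: "(nat \<times> nat) set \<Rightarrow> nat \<Rightarrow> nat \<Rightarrow> nat list \<Rightarrow> bool" where
  "is_path E a b p \<longleftrightarrow> p \<noteq> [] \<and> hd p = a \<and> last p = b \<and> distinct p \<and>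
     (\<forall>t. Suc t < length p \<longrightarrow> adjacent E (p ! t) (p ! Suc t))"

definition collider_at :: "(nat \<times> nat) set \<Rightarrow> nat list \<Rightarrow> nat \<Rightarrow> bool" where
  "collider_at E p t \<longleftrightarrow> (p ! (t - 1), p ! t) \<in> E \<and> (p ! Suc t, p ! t) \<in> E"

definition blocked :: "(nat \<times> nat) set \<Rightarrow> nat set \<Rightarrow> nat list \<Rightarrow> bool" where
  "blocked E C p \<longleftrightarrow> (\<exists>t. 0 < t \<and> Suc t < length p \<and>
     ((\<not> collider_at E p t \<and> p ! t \<in> C) \<or>
      (collider_at E p t \<and> p ! t \<notin> C \<and> (\<forall>d. (p ! t, d) \<in> E\<^sup>+ \<longrightarrow> d \<notin> C))))"

definition d_separates :: "(nat \<times> nat) set \<Rightarrow> nat set \<Rightarrow> nat \<Rightarrow> nat \<Rightarrow> bool" where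
  "d_separates E C a b \<longleftrightarrow> (\<forall>p. is_path E a b p \<longrightarrow> blocked E C p)"

definition mat_inv :: "real mat \<Rightarrow> real mat" where
  "mat_inv A = the (mat_inverse A)"

definition gauss_dag_model :: "nat \<Rightarrow> (nat \<times> nat) set \<Rightarrow> real mat set" where
  "gauss_dag_model n E =
    {transpose_mat (mat_inv (1\<^sub>m n - \<Lambda>)) * \<Omega> * mat_inv (1\<^sub>m n - \<Lambda>) | \<Lambda> \<Omega>.
       \<Lambda> \<in> carrier_mat n n \<and> (\<forall>u<n. \<forall>v<n. (u, v) \<notin> E \<longrightarrow> \<Lambda> $$ (u, v) = 0) \<and>
       \<Omega> \<in> carrier_mat n n \<and> diagonal_mat \<Omega> \<and> (\<forall>u<n. \<Omega> $$ (u, u) > 0)}"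

definition cov_mat :: "nat \<Rightarrow> real mat \<Rightarrow> bool" where
  "cov_mat n S \<longleftrightarrow> S \<in> carrier_mat n n \<and> transpose_mat S = S \<and>
     (\<forall>x \<in> carrier_vec n. x \<noteq> 0\<^sub>v n \<longrightarrow> x \<bullet> (S *\<^sub>v x) > 0)"

definition cond_cov :: "real mat \<Rightarrow> nat \<Rightarrow> nat \<Rightarrow> nat set \<Rightarrow> real" where
  "cond_cov S a b C = (submatrix S {a} {b} -
      submatrix S {a} C * mat_inv (submatrix S C C) * submatrix S C {b}) $$ (0, 0)"

definition partial_corr :: "real mat \<Rightarrow> nat \<Rightarrow> nat \<Rightarrow> nat set \<Rightarrow> real" where
  "partial_corr S a b C = cond_cov S a b C / sqrt (cond_cov S a a C * cond_cov S b b C)"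

definition approx_ci_model :: "nat \<Rightarrow> real \<Rightarrow> nat \<Rightarrow> nat \<Rightarrow> nat set \<Rightarrow> real mat set" where
  "approx_ci_model n \<delta> i j K = {S. cov_mat n S \<and> \<bar>partial_corr S i j K\<bar> \<le> \<delta>}"

end

theory Submission
  imports Defs "Jordan_Normal_Form.Determinant"
begin

text \<open>The conditional covariances given C are the reproducing kernel, on the functions vanishing on C, of
  the quadratic form of the precision matrix, which is a weighted sum over all nodes of squared
  residuals of the structural equations. Write T and S for the kernels given K and j, respectively given K.
  Then S(i,l) = T(i,l) + f g S(j,j), where f and g are the regression coefficients of i and l on j.

  If K and j d-separate i and l, then T(i,l) = 0 by the Markov property, and
  |corr(i,l)| = |corr(i,j)| |corr(j,l)|.

  Conversely, T does not depend on the edges out of j, and f and g are affine in their coefficients.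
  If some child of j is relevant to i given K and j, tuning its edge from j makes i and j uncorrelated,
  while T(i,l), and with it S(i,l), remains nonzero. If some child is relevant only to l, its edge tunes g
  so that |corr(i,l)| exceeds |corr(i,j)|. If no child is relevant to either, then making the edges out
  of j large drives S(j,j) to zero, or these edges do not matter and j can be isolated.
  Points where both T(i,l) and S(i,l) are nonzero exist by faithfulness and because the kernels are
  rational functions of the parameters.\<close>

text \<open>Choosing delta as the value of |rho_ij| at the point itself turns the family of
  inclusions into one pointwise inequality, |rho_il| <= |rho_ij| on the whole model. Choosing
  coefficients along a whole open path at once is awkward, since the walks that open its colliders
  interact. Faithfulness is therefore proved one edge at a time along walks, and each step may pick
  its own parameter point. Two properties of a node are carried along: its covariance with the start
  can be nonzero, and the covariance of its error term with the start can be nonzero. The first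
  passes to unobserved children; the second yields both at unobserved parents. Kernels for different
  parameters both vanish on C, so each is a test function in the reproducing identity of the other.
  Comparing the two energies isolates the perturbed term. In the converse, domination reads T^2 + 2
  T f g sigma <= f^2 sigma T(l,l) with T = T(i,l) and sigma = S(j,j). The positive term T^2, free of
  sigma, drives every case.\<close>

section \<open>Schur complements by solving linear systems\<close>

lemma bij_betw_pick:
  assumes "finite C"
  shows "bij_betw (pick C) {..<card C} C"
proof -
  have "inj_on (pick C) {..<card C}"
    by (rule linorder_inj_onI) (auto dest: pick_mono_le simp: less_imp_neq)
  moreover have "pick C ` {..<card C} \<subseteq> C" by (auto intro: pick_in_set_le)
  ultimately show ?thesis
    using assms by (simp add: bij_betw_def card_image card_subset_eq)
qed

lemma mult_mat_index:
  assumes "A \<in> carrier_mat p q" "B \<in> carrier_mat q r" "x < p" "y < r"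
  shows "(A * B) $$ (x, y) = (\<Sum>z<q. A $$ (x, z) * B $$ (z, y))"
  using assms by (auto simp: times_mat_def scalar_prod_def atLeast0LessThan)

lemma mat_inv_of_det:
  fixes A :: "real mat"
  assumes A: "A \<in> carrier_mat m m" and d: "det A \<noteq> 0"
  shows "mat_inv A \<in> carrier_mat m m" "A * mat_inv A = 1\<^sub>m m" "mat_inv A * A = 1\<^sub>m m"
proof -
  obtain B where "mat_inverse A = Some B"
    using mat_inverse(1) [OF A, of "()"] det_non_zero_imp_unit [OF A d, of "()"] by fastforce
  then show "mat_inv A \<in> carrier_mat m m" "A * mat_inv A = 1\<^sub>m m" "mat_inv A * A = 1\<^sub>m m"
    using mat_inverse(2) [OF A] by (auto simp: mat_inv_def)
qed

text \<open>Any solution z of the normal equations stands in for the inverse of the block at C.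
  Injectivity and solvability are phrased with sums over the set C, so that the positions used by
  \<open>submatrix\<close> occur only inside this proof.\<close>

lemma cond_cov_eq:
  assumes S: "S \<in> carrier_mat n n" and C: "C \<subseteq> {..<n}" and a: "a < n" and b: "b < n"
    and inj: "\<And>z. (\<And>c. c \<in> C \<Longrightarrow> (\<Sum>c'\<in>C. S $$ (c, c') * z c') = 0) \<Longrightarrow> (\<And>c. c \<in> C \<Longrightarrow> z c = 0)"
    and z: "\<And>c. c \<in> C \<Longrightarrow> (\<Sum>c'\<in>C. S $$ (c, c') * z c') = S $$ (c, b)"
  shows "cond_cov S a b C = S $$ (a, b) - (\<Sum>c\<in>C. S $$ (a, c) * z c)"
proof -
  define m where "m = card C"
  have fin: "finite C" using C finite_subset by blast
  have C': "{x. x < n \<and> x \<in> C} = C" "{x. x < n \<and> x \<in> {a}} = {a}" "{x. x < n \<and> x \<in> {b}} = {b}"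
    using C a b by auto
  note bij = bij_betw_pick [OF fin, folded m_def]
  have pick_C: "pick C k \<in> C" if "k < m" for k
    using that pick_in_set_le by (simp add: m_def)
  have sum_C: "(\<Sum>c\<in>C. f c) = (\<Sum>k<m. f (pick C k))" for f :: "nat \<Rightarrow> real"
    using sum.reindex_bij_betw [OF bij, of f] by simp
  \<comment> \<open>The first element picked from a singleton unfolds to this expression.\<close>
  have least: "(LEAST y. y = x) = x" for x :: nat by (rule Least_equality) auto
  define M where "M = submatrix S C C"
  have M: "M \<in> carrier_mat m m" "\<And>k k'. k < m \<Longrightarrow> k' < m \<Longrightarrow> M $$ (k, k') = S $$ (pick C k, pick C k')"
    using S C' by (auto simp: M_def submatrix_def m_def)
  define R where "R = submatrix S {a} C"
  have R: "R \<in> carrier_mat 1 m" "\<And>k. k < m \<Longrightarrow> R $$ (0, k) = S $$ (a, pick C k)"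
    using S C' by (auto simp: R_def submatrix_def m_def least)
  define Q where "Q = submatrix S C {b}"
  have Q: "Q \<in> carrier_mat m 1" "\<And>k. k < m \<Longrightarrow> Q $$ (k, 0) = S $$ (pick C k, b)"
    using S C' by (auto simp: Q_def submatrix_def m_def least)
  define D where "D = submatrix S {a} {b}"
  have D: "D \<in> carrier_mat 1 1" "D $$ (0, 0) = S $$ (a, b)"
    using S C' by (auto simp: D_def submatrix_def least)
  define Z where "Z = mat m 1 (\<lambda>(k, _). z (pick C k))"
  have Z: "Z \<in> carrier_mat m 1" by (simp add: Z_def)
  have "det M \<noteq> 0"
  proof
    assume "det M = 0"
    then obtain v where v: "v \<in> carrier_vec m" "v \<noteq> 0\<^sub>v m" "M *\<^sub>v v = 0\<^sub>v m"
      using det_0_iff_vec_prod_zero [OF M(1)] by blast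
    define y where "y c = v $ (the_inv_into {..<m} (pick C) c)" for c
    have y: "y (pick C k) = v $ k" if "k < m" for k
      using that bij by (simp add: y_def bij_betw_def the_inv_into_f_f)
    have "(\<Sum>c'\<in>C. S $$ (c, c') * y c') = 0" if c: "c \<in> C" for c
    proof -
      obtain k where k: "k < m" "c = pick C k" using c bij_betw_imp_surj_on [OF bij] by blast
      have "(M *\<^sub>v v) $ k = (\<Sum>k'<m. M $$ (k, k') * v $ k')"
        using k M(1) v(1) by (auto simp: mult_mat_vec_def scalar_prod_def atLeast0LessThan)
      then have "(\<Sum>k'<m. M $$ (k, k') * v $ k') = 0" using v(3) k by simp
      then show ?thesis unfolding sum_C using k M(2) y by simp
    qed
    then have "y c = 0" if "c \<in> C" for c by (rule inj) (use that in auto)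
    then have "v = 0\<^sub>v m" using v(1) y pick_C by (intro eq_vecI) (auto simp: y [symmetric])
    then show False using v(2) by simp
  qed
  note inv = mat_inv_of_det [OF M(1) this]
  have "M * Z = Q"
  proof (rule eq_matI)
    fix k k' assume "k < dim_row Q" "k' < dim_col Q"
    then have k: "k < m" "k' = 0" using Q(1) by auto
    have "(M * Z) $$ (k, 0) = (\<Sum>k''<m. M $$ (k, k'') * Z $$ (k'', 0))"
      by (rule mult_mat_index [OF M(1) Z]) (use k in auto)
    then have "(M * Z) $$ (k, 0) = (\<Sum>c\<in>C. S $$ (pick C k, c) * z c)"
      unfolding sum_C using k M(2) by (simp add: Z_def)
    then show "(M * Z) $$ (k, k') = Q $$ (k, k')" using z [OF pick_C] k Q(2) by simp
  qed (use M Z Q in auto)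
  then have "R * mat_inv M * Q = R * mat_inv M * (M * Z)" by simp
  also have "\<dots> = R * (mat_inv M * M) * Z"
    using R(1) inv(1) M(1) Z by (simp add: assoc_mult_mat [of _ 1 m _ m _ m] assoc_mult_mat [of _ 1 m _ m _ 1]
        assoc_mult_mat [of _ m m _ m _ 1])
  also have "\<dots> = R * Z" using inv(3) R(1) by simp
  finally have "cond_cov S a b C = (D - R * Z) $$ (0, 0)"
    by (simp add: cond_cov_def D_def R_def Q_def M_def)
  also have "\<dots> = D $$ (0, 0) - (R * Z) $$ (0, 0)" using D(1) R(1) Z by simp
  also have "(R * Z) $$ (0, 0) = (\<Sum>k<m. R $$ (0, k) * Z $$ (k, 0))"
    by (rule mult_mat_index [OF R(1) Z]) auto
  also have "\<dots> = (\<Sum>c\<in>C. S $$ (a, c) * z c)"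
    unfolding sum_C using R(2) by (simp add: Z_def)
  finally show ?thesis using D by simp
qed

section \<open>Conditional covariances as reproducing kernels\<close>

locale finite_dag =
  fixes n :: nat and E :: "(nat \<times> nat) set"
  assumes dag: "dag n E"
begin

lemma edge_bounds: "(u, v) \<in> E \<Longrightarrow> u < n" "(u, v) \<in> E \<Longrightarrow> v < n"
  using dag by (auto simp: dag_def)

lemma acyclic_E: "acyclic E"
  using dag by (simp add: dag_def)

lemma no_loop: "(v, v) \<notin> E"
  using acyclic_E by (auto simp: acyclic_def)

lemma no_two_cycle: "(u, v) \<in> E \<Longrightarrow> (v, u) \<notin> E"
  using acyclic_E by (meson acyclic_def trancl.simps)

lemma finite_E: "finite E"
  using dag unfolding dag_def by (meson finite_SigmaI finite_lessThan finite_subset)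

lemma wf_E: "wf E"
  by (simp add: acyclic_E finite_E finite_acyclic_wf)

lemma wf_E_converse: "wf (E\<inverse>)"
  by (simp add: acyclic_E finite_E finite_acyclic_wf_converse)

text \<open>The parameters are the edge coefficients L and the reciprocals w of the error variances; energy is the
  bilinear form of the precision matrix, and the kernel at a, b is the conditional covariance
  of a and b given C. Functions on the nodes are extended by 0 beyond n.\<close>

definition res :: "(nat \<Rightarrow> nat \<Rightarrow> real) \<Rightarrow> nat \<Rightarrow> (nat \<Rightarrow> real) \<Rightarrow> real" where
  "res L v t = t v - (\<Sum>u<n. L u v * t u)"

definition energy :: "(nat \<Rightarrow> nat \<Rightarrow> real) \<Rightarrow> (nat \<Rightarrow> real) \<Rightarrow> (nat \<Rightarrow> real) \<Rightarrow> (nat \<Rightarrow> real) \<Rightarrow> real" where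
  "energy L w s t = (\<Sum>v<n. w v * res L v s * res L v t)"

definition vanishing :: "nat set \<Rightarrow> (nat \<Rightarrow> real) set" where
  "vanishing C = {t. \<forall>x. x \<in> C \<or> n \<le> x \<longrightarrow> t x = 0}"

definition params :: "(nat \<Rightarrow> nat \<Rightarrow> real) \<Rightarrow> (nat \<Rightarrow> real) \<Rightarrow> bool" where
  "params L w \<longleftrightarrow> (\<forall>u v. (u, v) \<notin> E \<longrightarrow> L u v = 0) \<and> (\<forall>v. w v > 0)"

definition is_kernel where
  "is_kernel L w C a t \<longleftrightarrow> t \<in> vanishing C \<and> (\<forall>s\<in>vanishing C. energy L w s t = s a)"

definition kernel :: "(nat \<Rightarrow> nat \<Rightarrow> real) \<Rightarrow> (nat \<Rightarrow> real) \<Rightarrow> nat set \<Rightarrow> nat \<Rightarrow> nat \<Rightarrow> real" where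
  "kernel L w C a = (THE t. is_kernel L w C a t)"

abbreviation unit_fun :: "nat \<Rightarrow> nat \<Rightarrow> real" where
  "unit_fun a \<equiv> (\<lambda>x. if x = a then 1 else 0)"

lemma res_add: "res L v (\<lambda>x. s x + t x) = res L v s + res L v t"
  by (simp add: res_def algebra_simps sum.distrib)

lemma res_diff: "res L v (\<lambda>x. s x - t x) = res L v s - res L v t"
  by (simp add: res_def algebra_simps sum_subtractf)

lemma res_scale: "res L v (\<lambda>x. c * t x) = c * res L v t"
  by (simp add: res_def algebra_simps sum_distrib_left)

lemma res_zero [simp]: "res L v (\<lambda>x. 0) = 0"
  by (simp add: res_def)

lemma res_unit_fun: "y < n \<Longrightarrow> res L v (unit_fun y) = (if v = y then 1 else 0) - L y v"
  by (simp add: res_def if_distrib [of "\<lambda>z. _ * z"] cong: if_cong)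

lemma energy_commute: "energy L w s t = energy L w t s"
  by (simp add: energy_def mult.assoc mult.left_commute mult.commute)

lemma energy_add: "energy L w (\<lambda>x. s x + s' x) t = energy L w s t + energy L w s' t"
  by (simp add: energy_def res_add algebra_simps sum.distrib)

lemma energy_diff: "energy L w (\<lambda>x. s x - s' x) t = energy L w s t - energy L w s' t"
  by (simp add: energy_def res_diff algebra_simps sum_subtractf)

lemma energy_scale: "energy L w (\<lambda>x. c * s x) t = c * energy L w s t"
  by (simp add: energy_def res_scale sum_distrib_left algebra_simps)

lemma energy_diff_right: "energy L w t (\<lambda>x. s x - s' x) = energy L w t s - energy L w t s'"
  by (simp add: energy_def res_diff algebra_simps sum_subtractf)

lemma energy_scale_right: "energy L w t (\<lambda>x. c * s x) = c * energy L w t s"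
  by (simp add: energy_def res_scale sum_distrib_left algebra_simps)

lemma energy_sum: "finite I \<Longrightarrow> energy L w (\<lambda>x. \<Sum>i\<in>I. c i * f i x) t = (\<Sum>i\<in>I. c i * energy L w (f i) t)"
proof (induction I rule: finite_induct)
  case empty
  show ?case by (simp add: energy_def)
next
  case (insert i I)
  then show ?case by (simp add: energy_add energy_scale)
qed

lemma vanishing_add: "s \<in> vanishing C \<Longrightarrow> t \<in> vanishing C \<Longrightarrow> (\<lambda>x. s x + t x) \<in> vanishing C"
  by (simp add: vanishing_def)

lemma vanishing_diff: "s \<in> vanishing C \<Longrightarrow> t \<in> vanishing C \<Longrightarrow> (\<lambda>x. s x - t x) \<in> vanishing C"
  by (simp add: vanishing_def)

lemma vanishing_scale: "s \<in> vanishing C \<Longrightarrow> (\<lambda>x. c * s x) \<in> vanishing C"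
  by (simp add: vanishing_def)

lemma vanishing_mono: "C \<subseteq> D \<Longrightarrow> t \<in> vanishing D \<Longrightarrow> t \<in> vanishing C"
  by (auto simp: vanishing_def)

lemma unit_fun_vanishing: "x < n \<Longrightarrow> x \<notin> C \<Longrightarrow> unit_fun x \<in> vanishing C"
  by (auto simp: vanishing_def)

lemma unit_fun_expansion: "t \<in> vanishing C \<Longrightarrow> t = (\<lambda>x. \<Sum>y<n. t y * unit_fun y x)"
  by (rule ext) (auto simp: vanishing_def if_distrib [of "\<lambda>z. _ * z"] cong: if_cong)

lemma energy_expansion:
  "s \<in> vanishing C \<Longrightarrow> energy L w s t = (\<Sum>y<n. s y * energy L w (unit_fun y) t)"
  by (subst unit_fun_expansion [of s C], assumption) (rule energy_sum, simp)

lemma energy_unit_fun: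
  assumes "params L w" "y < n"
  shows "energy L w (unit_fun y) t = w y * res L y t - (\<Sum>v<n. L y v * w v * res L v t)"
proof -
  have "energy L w (unit_fun y) t
      = (\<Sum>v<n. (if v = y then w v * res L v t else 0) - L y v * w v * res L v t)"
    unfolding energy_def res_unit_fun [OF assms(2)]
    by (intro sum.cong) (auto simp: algebra_simps)
  then show ?thesis using assms(2) by (simp add: sum_subtractf)
qed

text \<open>Induction along the edges: once all parents of a node have value 0, its residual is its
  value. Residuals at nodes of C are left free, because there the value itself is 0;
  \<open>relevant_observed\<close> relies on this.\<close>

lemma res_all_zero:
  assumes p: "params L w" and t: "t \<in> vanishing C"
    and r: "\<And>v. v < n \<Longrightarrow> v \<notin> C \<Longrightarrow> res L v t = 0"
  shows "t = (\<lambda>x. 0)"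
proof
  fix x
  show "t x = 0"
  proof (induction x rule: wf_induct_rule [OF wf_E])
    case (1 x)
    show ?case
    proof (cases "x < n \<and> x \<notin> C")
      case True
      have "L u x * t u = 0" for u
        using 1 p by (cases "(u, x) \<in> E") (auto simp: params_def)
      then have "(\<Sum>u<n. L u x * t u) = 0" by (intro sum.neutral) blast
      then show ?thesis using r [of x] True by (simp add: res_def)
    next
      case False
      then show ?thesis using t by (auto simp: vanishing_def not_less)
    qed
  qed
qed

lemma energy_zero_res:
  assumes "params L w" "energy L w t t = 0" "v < n"
  shows "res L v t = 0"
proof -
  have "\<forall>v\<in>{..<n}. w v * res L v t * res L v t = 0"
    using assms(2) unfolding energy_def
    by (subst (asm) sum_nonneg_eq_0_iff)
       (use assms(1) in \<open>auto simp: params_def mult.assoc less_imp_le\<close>)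
  then have "w v * res L v t * res L v t = 0" using assms(3) by blast
  moreover have "w v > 0" using assms(1) by (simp add: params_def)
  ultimately show ?thesis by simp
qed

lemma energy_nonneg: "params L w \<Longrightarrow> energy L w t t \<ge> 0"
  unfolding energy_def by (intro sum_nonneg) (simp add: params_def mult.assoc less_imp_le)

lemma energy_definite:
  assumes "params L w" "t \<in> vanishing C" "energy L w t t = 0"
  shows "t = (\<lambda>x. 0)"
  by (rule res_all_zero [OF assms(1,2)]) (simp add: energy_zero_res [OF assms(1,3)])

text \<open>Padding with the identity on C avoids reindexing the complement of C.\<close>

definition energy_mat where
  "energy_mat L w C = mat n n (\<lambda>(x, y). if x \<in> C \<or> y \<in> C then (if x = y then 1 else 0)
      else \<Sum>v<n. w v * ((if v = x then 1 else 0) - L x v) * ((if v = y then 1 else 0) - L y v))"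

lemma energy_mat_carrier: "energy_mat L w C \<in> carrier_mat n n"
  by (simp add: energy_mat_def)

lemma energy_mat_index:
  assumes "x < n" "y < n"
  shows "energy_mat L w C $$ (x, y) = (if x \<in> C \<or> y \<in> C then (if x = y then 1 else 0)
      else energy L w (unit_fun x) (unit_fun y))"
  using assms by (simp add: energy_mat_def energy_def res_unit_fun)

lemma energy_mat_apply:
  assumes t: "t \<in> vanishing C" and x: "x < n" "x \<notin> C"
  shows "(\<Sum>y<n. energy_mat L w C $$ (x, y) * t y) = energy L w (unit_fun x) t"
proof -
  have "energy L w (unit_fun x) t = (\<Sum>y<n. t y * energy L w (unit_fun x) (unit_fun y))"
    by (subst energy_commute) (simp add: energy_expansion [OF t] energy_commute)
  also have "\<dots> = (\<Sum>y<n. energy_mat L w C $$ (x, y) * t y)"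
    using x t by (intro sum.cong) (auto simp: energy_mat_index vanishing_def)
  finally show ?thesis by simp
qed

text \<open>The identity rows make a null vector vanish on C, and the other rows then give it energy
  0.\<close>

lemma energy_mat_det:
  assumes p: "params L w"
  shows "det (energy_mat L w C) \<noteq> 0"
proof
  assume "det (energy_mat L w C) = 0"
  then obtain v where v: "v \<in> carrier_vec n" "v \<noteq> 0\<^sub>v n" "energy_mat L w C *\<^sub>v v = 0\<^sub>v n"
    using det_0_iff_vec_prod_zero [OF energy_mat_carrier] by blast
  define t where "t x = (if x < n then v $ x else 0)" for x
  have row: "(\<Sum>y<n. energy_mat L w C $$ (x, y) * t y) = 0" if "x < n" for x
  proof -
    have "(energy_mat L w C *\<^sub>v v) $ x = (\<Sum>y<n. energy_mat L w C $$ (x, y) * t y)"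
      using that v(1) energy_mat_carrier [of L w C]
      by (auto simp: mult_mat_vec_def scalar_prod_def t_def atLeast0LessThan intro!: sum.cong)
    then show ?thesis using v(3) that by simp
  qed
  have "t x = 0" if "x \<in> C" "x < n" for x
  proof -
    have "(\<Sum>y<n. energy_mat L w C $$ (x, y) * t y) = (\<Sum>y<n. if y = x then t y else 0)"
      using that by (intro sum.cong) (auto simp: energy_mat_index)
    then show ?thesis using row [OF that(2)] that by simp
  qed
  then have t: "t \<in> vanishing C"
    by (auto simp: vanishing_def t_def)
  have "energy L w t t = (\<Sum>x<n. t x * energy L w (unit_fun x) t)"
    by (rule energy_expansion [OF t])
  also have "\<dots> = 0"
  proof (intro sum.neutral ballI)
    fix x assume "x \<in> {..<n}"
    then show "t x * energy L w (unit_fun x) t = 0"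
      using row [of x] energy_mat_apply [OF t, of x] t by (cases "x \<in> C") (auto simp: vanishing_def)
  qed
  finally have "t = (\<lambda>x. 0)" using energy_definite [OF p t] by simp
  then have "v = 0\<^sub>v n"
    using v(1) by (intro eq_vecI) (auto simp: t_def fun_eq_iff split: if_splits)
  then show False using v(2) by simp
qed

section \<open>Existence, uniqueness and genericity of kernels\<close>

lemma is_kernel_unique:
  assumes "params L w" "is_kernel L w C a t" "is_kernel L w C a t'"
  shows "t = t'"
proof -
  have m: "(\<lambda>x. t x - t' x) \<in> vanishing C"
    using assms by (simp add: is_kernel_def vanishing_diff)
  have "energy L w (\<lambda>x. t x - t' x) (\<lambda>x. t x - t' x) = 0"
    using assms m by (simp add: is_kernel_def energy_diff_right)
  then have "(\<lambda>x. t x - t' x) = (\<lambda>x. 0)"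
    using energy_definite [OF assms(1) m] by simp
  then show ?thesis by (simp add: fun_eq_iff)
qed

text \<open>Cramer's rule rather than bare existence: numerator and denominator are polynomials in
  the parameters, which \<open>kernel_generic\<close> exploits.\<close>

lemma is_kernel_cofactor:
  assumes p: "params L w" and a: "a < n" "a \<notin> C"
  shows "is_kernel L w C a (\<lambda>x. if x < n
     then cofactor (energy_mat L w C) a x / det (energy_mat L w C) else 0)" (is "is_kernel L w C a ?t")
proof -
  let ?M = "energy_mat L w C"
  have d: "det ?M \<noteq> 0" by (rule energy_mat_det [OF p])
  have row: "(\<Sum>y<n. ?M $$ (x, y) * ?t y) = (if x = a then 1 else 0)" if "x < n" for x
  proof -
    have "(?M * adj_mat ?M) $$ (x, a) = (\<Sum>y<n. ?M $$ (x, y) * cofactor ?M a y)"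
      using that a energy_mat_carrier [of L w C]
      by (auto simp: times_mat_def scalar_prod_def adj_mat_def atLeast0LessThan intro!: sum.cong)
    moreover have "(?M * adj_mat ?M) $$ (x, a) = (if x = a then det ?M else 0)"
      using that a by (simp add: adj_mat(2) [OF energy_mat_carrier])
    ultimately have *: "(\<Sum>y<n. ?M $$ (x, y) * cofactor ?M a y) = (if x = a then det ?M else 0)"
      by simp
    have "(\<Sum>y<n. ?M $$ (x, y) * ?t y) = (\<Sum>y<n. ?M $$ (x, y) * cofactor ?M a y) / det ?M"
      by (subst sum_divide_distrib) (auto intro!: sum.cong)
    then show ?thesis using * d by simp
  qed
  have "?t x = 0" if "x \<in> C" "x < n" for x
  proof -
    have "(\<Sum>y<n. ?M $$ (x, y) * ?t y) = (\<Sum>y<n. if y = x then ?t y else 0)"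
      using that by (intro sum.cong) (auto simp: energy_mat_index)
    then show ?thesis using row [OF that(2)] that a by auto
  qed
  then have t: "?t \<in> vanishing C" unfolding vanishing_def by force
  have "energy L w s ?t = s a" if s: "s \<in> vanishing C" for s
  proof -
    have "energy L w s ?t = (\<Sum>y<n. s y * energy L w (unit_fun y) ?t)"
      by (rule energy_expansion [OF s])
    also have "\<dots> = (\<Sum>y<n. if y = a then s y else 0)"
    proof (intro sum.cong refl)
      fix y assume "y \<in> {..<n}"
      then show "s y * energy L w (unit_fun y) ?t = (if y = a then s y else 0)"
        using row [of y] energy_mat_apply [OF t, of y L w] s a
        by (cases "y \<in> C") (auto simp: vanishing_def)
    qed
    also have "\<dots> = s a" using a by simp
    finally show ?thesis .
  qed
  with t show ?thesis unfolding is_kernel_def by blast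
qed

lemma kernel_eqI: "params L w \<Longrightarrow> is_kernel L w C a t \<Longrightarrow> kernel L w C a = t"
  unfolding kernel_def by (rule the_equality) (auto intro: is_kernel_unique)

lemma kernel_is_kernel:
  "params L w \<Longrightarrow> a < n \<Longrightarrow> a \<notin> C \<Longrightarrow> is_kernel L w C a (kernel L w C a)"
  by (simp add: kernel_eqI [OF _ is_kernel_cofactor] is_kernel_cofactor)

lemma kernel_vanishing:
  "params L w \<Longrightarrow> a < n \<Longrightarrow> a \<notin> C \<Longrightarrow> kernel L w C a \<in> vanishing C"
  using kernel_is_kernel is_kernel_def by blast

lemma kernel_reproducing:
  "params L w \<Longrightarrow> a < n \<Longrightarrow> a \<notin> C \<Longrightarrow> s \<in> vanishing C \<Longrightarrow> energy L w s (kernel L w C a) = s a"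
  using kernel_is_kernel is_kernel_def by blast

lemma kernel_symmetric:
  assumes "params L w" "a < n" "a \<notin> C" "b < n" "b \<notin> C"
  shows "kernel L w C a b = kernel L w C b a"
  using assms kernel_reproducing kernel_vanishing energy_commute by metis

lemma kernel_diag_pos:
  assumes "params L w" "a < n" "a \<notin> C"
  shows "kernel L w C a a > 0"
proof -
  let ?t = "kernel L w C a"
  have v: "?t \<in> vanishing C" using kernel_vanishing assms by simp
  have e: "energy L w ?t ?t = ?t a" using kernel_reproducing assms v by simp
  have "?t a \<noteq> 0"
  proof
    assume "?t a = 0"
    then have "?t = (\<lambda>x. 0)" using e energy_definite assms(1) v by auto
    then have "energy L w (unit_fun a) (\<lambda>x. 0) = 1"
      using kernel_reproducing [OF assms unit_fun_vanishing [OF assms(2,3)]] by simp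
    then show False by (simp add: energy_def)
  qed
  then show ?thesis using e energy_nonneg [OF assms(1), of ?t] by simp
qed

text \<open>The admissible parameters are convex, so the segment between the two points stays in the
  model. Along it each of the two cofactors is a polynomial that is nonzero at one end, and their
  product has only finitely many roots.\<close>

lemma kernel_generic:
  assumes p1: "params L1 w1" and a1: "a1 < n" "a1 \<notin> C1" and b1: "b1 < n"
    and p2: "params L2 w2" and a2: "a2 < n" "a2 \<notin> C2" and b2: "b2 < n"
    and nz1: "kernel L1 w1 C1 a1 b1 \<noteq> 0" and nz2: "kernel L2 w2 C2 a2 b2 \<noteq> 0"
  shows "\<exists>L w. params L w \<and> kernel L w C1 a1 b1 \<noteq> 0 \<and> kernel L w C2 a2 b2 \<noteq> 0"
proof -
  define L where "L s u v = (1 - s) * L1 u v + s * L2 u v" for s :: real and u v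
  define w where "w s v = (1 - s) * w1 v + s * w2 v" for s :: real and v
  \<comment> \<open>Edge coefficients and padded form matrix along the segment, with the segment
    parameter as the indeterminate.\<close>
  define PL where "PL u v = [:L1 u v, L2 u v - L1 u v:]" for u v
  define PM where "PM C = mat n n (\<lambda>(x, y). if x \<in> C \<or> y \<in> C then (if x = y then 1 else 0)
      else \<Sum>v<n. [:w1 v, w2 v - w1 v:] * ((if v = x then 1 else 0) - PL x v)
                   * ((if v = y then 1 else 0) - PL y v))" for C
  have par: "params (L s) (w s)" if "0 \<le> s" "s \<le> 1" for s
    unfolding params_def
  proof (intro conjI allI impI)
    show "(u, v) \<notin> E \<Longrightarrow> L s u v = 0" for u v using p1 p2 by (simp add: L_def params_def)
    have "w1 v > 0" "w2 v > 0" for v using p1 p2 by (auto simp: params_def)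
    then show "w s v > 0" for v
      unfolding w_def using that
      by (cases "s = 0") (auto intro!: add_nonneg_pos simp: less_imp_le)
  qed
  have ev: "map_mat (\<lambda>q. poly q s) (PM C) = energy_mat (L s) (w s) C" for s C
    by (rule eq_matI)
       (auto simp: PM_def PL_def energy_mat_def poly_sum L_def w_def algebra_simps intro!: sum.cong)
  interpret ev: comm_ring_hom "\<lambda>q::real poly. poly q s" for s
    by unfold_locales simp_all
  have cof: "cofactor (energy_mat (L s) (w s) C) a b = poly (cofactor (PM C) a b) s"
    if "a < n" "b < n" for s C a b
  proof -
    have "mat_delete (map_mat (\<lambda>q. poly q s) (PM C)) a b = map_mat (\<lambda>q. poly q s) (mat_delete (PM C) a b)"
      by (rule eq_matI) (use that in \<open>auto simp: mat_delete_def PM_def\<close>)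
    then show ?thesis by (simp add: cofactor_def ev [symmetric])
  qed
  have ker: "kernel (L s) (w s) C a b \<noteq> 0 \<longleftrightarrow> poly (cofactor (PM C) a b) s \<noteq> 0"
    if "0 \<le> s" "s \<le> 1" "a < n" "a \<notin> C" "b < n" for s C a b
    using kernel_eqI [OF par is_kernel_cofactor [OF par]] that energy_mat_det [OF par]
    by (simp add: cof)
  have "L 0 = L1" "w 0 = w1" "L 1 = L2" "w 1 = w2" by (auto simp: L_def w_def fun_eq_iff)
  then have "poly (cofactor (PM C1) a1 b1) 0 \<noteq> 0" "poly (cofactor (PM C2) a2 b2) 1 \<noteq> 0"
    using ker [of 0 a1 C1 b1] ker [of 1 a2 C2 b2] assms by simp_all
  then have "cofactor (PM C1) a1 b1 * cofactor (PM C2) a2 b2 \<noteq> 0" by auto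
  then have fin: "finite {s. poly (cofactor (PM C1) a1 b1 * cofactor (PM C2) a2 b2) s = 0}"
    by (rule poly_roots_finite)
  have "\<not> {0..1} \<subseteq> {s. poly (cofactor (PM C1) a1 b1 * cofactor (PM C2) a2 b2) s = 0}"
    (is "\<not> _ \<subseteq> ?Z")
  proof
    assume "{0..1} \<subseteq> ?Z"
    then have "finite {0..1::real}" using fin by (rule finite_subset)
    then show False using infinite_Icc [of "0::real" 1] by simp
  qed
  then obtain s where s: "s \<in> {0..1}"
    "poly (cofactor (PM C1) a1 b1 * cofactor (PM C2) a2 b2) s \<noteq> 0"
    by blast
  then have "kernel (L s) (w s) C1 a1 b1 \<noteq> 0 \<and> kernel (L s) (w s) C2 a2 b2 \<noteq> 0"
    using assms by (simp add: ker)
  then show ?thesis using par s(1) by auto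
qed

section \<open>Faithfulness\<close>

text \<open>The flag records whether the last edge of the walk points into its end node. In the rule collider,
  d may be the end node itself.\<close>

inductive conn :: "nat set \<Rightarrow> nat \<Rightarrow> nat \<Rightarrow> bool \<Rightarrow> bool" for C a where
  start: "conn C a a False"
| forward: "conn C a x h \<Longrightarrow> x \<notin> C \<Longrightarrow> (x, y) \<in> E \<Longrightarrow> conn C a y True"
| backward: "conn C a x False \<Longrightarrow> x \<notin> C \<Longrightarrow> (y, x) \<in> E \<Longrightarrow> conn C a y False"
| collider: "conn C a x True \<Longrightarrow> (x, d) \<in> E\<^sup>* \<Longrightarrow> d \<in> C \<Longrightarrow> (y, x) \<in> E \<Longrightarrow> conn C a y False"

section \<open>Perturbing an edge coefficient or an error variance\<close>

definition shift_edge :: "(nat \<Rightarrow> nat \<Rightarrow> real) \<Rightarrow> nat \<Rightarrow> nat \<Rightarrow> (nat \<Rightarrow> nat \<Rightarrow> real)" where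
  "shift_edge L u v = L(u := (L u)(v := L u v + 1))"

definition drop_in :: "(nat \<Rightarrow> nat \<Rightarrow> real) \<Rightarrow> nat \<Rightarrow> (nat \<Rightarrow> nat \<Rightarrow> real)" where
  "drop_in L y u v = (if v = y then 0 else L u v)"

definition drop_out :: "(nat \<Rightarrow> nat \<Rightarrow> real) \<Rightarrow> nat \<Rightarrow> (nat \<Rightarrow> nat \<Rightarrow> real)" where
  "drop_out L y u v = (if u = y then 0 else L u v)"

lemma params_shift_edge: "params L w \<Longrightarrow> (u, v) \<in> E \<Longrightarrow> params (shift_edge L u v) w"
  by (auto simp: params_def shift_edge_def)

lemma params_drop_in: "params L w \<Longrightarrow> params (drop_in L y) w"
  by (auto simp: params_def drop_in_def)

lemma params_drop_out: "params L w \<Longrightarrow> params (drop_out L y) w"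
  by (auto simp: params_def drop_out_def)

lemma res_shift_edge:
  assumes "u < n"
  shows "res (shift_edge L u v) x t = res L x t - (if x = v then t u else 0)"
proof -
  have "(\<Sum>z<n. shift_edge L u v z x * t z)
      = (\<Sum>z<n. L z x * t z + (if z = u then (if x = v then t z else 0) else 0))"
    by (intro sum.cong) (auto simp: shift_edge_def algebra_simps)
  then show ?thesis using assms by (simp add: res_def sum.distrib)
qed

lemma res_drop_in: "res (drop_in L y) x t = (if x = y then t y else res L x t)"
  by (simp add: res_def drop_in_def)

lemma res_drop_out:
  assumes "y < n"
  shows "res (drop_out L y) x t = res L x t + L y x * t y"
proof -
  have "(\<Sum>z<n. drop_out L y z x * t z)
      = (\<Sum>z<n. L z x * t z - (if z = y then L z x * t z else 0))"
    by (intro sum.cong) (auto simp: drop_out_def)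
  then show ?thesis using assms by (simp add: res_def sum_subtractf)
qed

text \<open>If the perturbed kernel also vanished at y, the perturbed energy of t (old kernel at a)
  and g (new kernel at y) would have two values: it is t y = 0, and it differs from g a = 0 by
  \<open>w x * g y * res L x t\<close>, which is nonzero.\<close>

lemma kernel_shift_edge:
  assumes p: "params L w" and a: "a < n" "a \<notin> C" and e: "(y, x) \<in> E" and y: "y \<notin> C"
    and 0: "kernel L w C a y = 0" and r: "res L x (kernel L w C a) \<noteq> 0"
  shows "kernel (shift_edge L y x) w C a y \<noteq> 0"
proof
  assume 1: "kernel (shift_edge L y x) w C a y = 0"
  let ?L = "shift_edge L y x"
  have yx: "y < n" "x < n" using e edge_bounds by auto
  have p1: "params ?L w" by (rule params_shift_edge [OF p e])
  define t where "t = kernel L w C a"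
  define g where "g = kernel ?L w C y"
  have vt: "t \<in> vanishing C" and vg: "g \<in> vanishing C"
    using kernel_vanishing p p1 a yx y by (simp_all add: t_def g_def)
  have "energy ?L w g t = (\<Sum>v<n. w v * res L v g * res L v t - (if v = x then w v * g y * res L v t else 0))"
    unfolding energy_def
    by (intro sum.cong) (use 0 yx in \<open>auto simp: res_shift_edge t_def algebra_simps\<close>)
  also have "\<dots> = energy L w g t - w x * g y * res L x t"
    using yx by (simp add: energy_def sum_subtractf)
  also have "energy L w g t = g a"
    unfolding t_def by (rule kernel_reproducing [OF p a vg])
  also have "g a = 0"
    using 1 kernel_symmetric [OF p1 a yx(1) y] by (simp add: g_def)
  finally have "energy ?L w g t = - (w x * g y * res L x t)" by simp
  moreover have "energy ?L w g t = 0"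
    using kernel_reproducing [OF p1 yx(1) y vt] 0 by (simp add: energy_commute g_def t_def)
  moreover have "w x > 0" using p by (simp add: params_def)
  moreover have "g y > 0" unfolding g_def by (rule kernel_diag_pos [OF p1 yx(1) y])
  ultimately show False using r by (simp add: t_def)
qed

definition linked :: "nat set \<Rightarrow> nat \<Rightarrow> nat \<Rightarrow> bool" where
  "linked C a x \<longleftrightarrow> (\<exists>L w. params L w \<and> kernel L w C a x \<noteq> 0)"

text \<open>The residual at v of the kernel at a is the conditional covariance of the error term of
  v with a given C. It can be nonzero even for v in C.\<close>

definition relevant :: "nat set \<Rightarrow> nat \<Rightarrow> nat \<Rightarrow> bool" where
  "relevant C a v \<longleftrightarrow> (\<exists>L w. params L w \<and> res L v (kernel L w C a) \<noteq> 0)"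

text \<open>Either the kernel is already nonzero at y where x has nonzero residual, or increasing
  the coefficient of the edge makes it so.\<close>

lemma linked_parent:
  assumes "a < n" "a \<notin> C" "(y, x) \<in> E" "y \<notin> C" "relevant C a x"
  shows "linked C a y"
  using assms kernel_shift_edge params_shift_edge unfolding linked_def relevant_def by metis

lemma energy_weight_update:
  assumes "x < n"
  shows "energy L (w(x := w x + 1)) s t = energy L w s t + res L x s * res L x t"
proof -
  have "energy L (w(x := w x + 1)) s t
      = (\<Sum>v<n. w v * res L v s * res L v t + (if v = x then res L v s * res L v t else 0))"
    unfolding energy_def by (intro sum.cong) (auto simp: algebra_simps)
  then show ?thesis using assms by (simp add: energy_def sum.distrib)
qed

text \<open>Testing each kernel with the other shows that the variance of a drops by the product of
  the two residuals at x; if the new residual is 0, the two kernels coincide. Relevance of x thus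
  becomes visible in a single number, which \<open>relevant_parent\<close> can compare across
  parameter points.\<close>

lemma kernel_weight_update:
  assumes p: "params L w" and a: "a < n" "a \<notin> C" and x: "x < n"
  shows "kernel L w C a a = kernel L (w(x := w x + 1)) C a a \<longleftrightarrow> res L x (kernel L w C a) = 0"
proof -
  let ?w = "w(x := w x + 1)"
  have p': "params L ?w" using p by (auto simp: params_def add_pos_pos)
  define t where "t = kernel L w C a"
  define t' where "t' = kernel L ?w C a"
  have vt: "t \<in> vanishing C" and vt': "t' \<in> vanishing C"
    using kernel_vanishing p p' a by (simp_all add: t_def t'_def)
  have "t a = energy L ?w t t'" using kernel_reproducing [OF p' a vt] by (simp add: t'_def)
  also have "\<dots> = energy L w t' t + res L x t * res L x t'"
    by (simp add: energy_weight_update [OF x] energy_commute)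
  also have "energy L w t' t = t' a" using kernel_reproducing [OF p a vt'] by (simp add: t_def)
  finally have eq: "t a = t' a + res L x t * res L x t'" .
  have "res L x t = 0" if "res L x t' = 0"
  proof -
    have "energy L w s t' = s a" if "s \<in> vanishing C" for s
      using kernel_reproducing [OF p' a that] energy_weight_update [OF x, of L w s t']
        \<open>res L x t' = 0\<close> by (simp add: t'_def [symmetric])
    then have "is_kernel L w C a t'" using vt' by (simp add: is_kernel_def)
    then have "t = t'" unfolding t_def by (rule kernel_eqI [OF p])
    then show ?thesis using that by simp
  qed
  then show ?thesis using eq by (auto simp: t_def [symmetric] t'_def [symmetric])
qed

text \<open>If the residual at y vanished identically, the diagonal entry of the kernel would not depend
  on the edges into y; after deleting them, it would not depend on the weight of the child x.\<close>

lemma relevant_parent: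
  assumes a: "a < n" "a \<notin> C" and e: "(y, x) \<in> E" and y: "y \<notin> C" and rel: "relevant C a x"
  shows "relevant C a y"
proof (rule ccontr)
  assume "\<not> relevant C a y"
  then have zero: "res L y (kernel L w C a) = 0" if "params L w" for L w
    using that by (auto simp: relevant_def)
  have yx: "y < n" "x < n" "x \<noteq> y" using e edge_bounds no_loop by auto
  \<comment> \<open>Without edges into y the residual at y is the value at y, so the kernel would
    vanish at y even after the edge from y to x is perturbed.\<close>
  have isolated: "res (drop_in L y) x (kernel (drop_in L y) w C a) = 0" if p: "params L w" for L w
  proof (rule ccontr)
    let ?L = "drop_in L y"
    assume r: "res ?L x (kernel ?L w C a) \<noteq> 0"
    have p0: "params ?L w" by (rule params_drop_in [OF p])
    have "kernel ?L w C a y = 0" using zero [OF p0] by (simp add: res_drop_in)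
    then have "kernel (shift_edge ?L y x) w C a y \<noteq> 0"
      using kernel_shift_edge [OF p0 a e y] r by blast
    moreover have "res (shift_edge ?L y x) y (kernel (shift_edge ?L y x) w C a) = 0"
      by (rule zero [OF params_shift_edge [OF p0 e]])
    ultimately show False using yx by (simp add: res_shift_edge res_drop_in)
  qed
  \<comment> \<open>The two energies differ only in the summand at y, and there one factor is 0 on
    either side.\<close>
  have diag: "kernel L w C a a = kernel (drop_in L y) w C a a" if p: "params L w" for L w
  proof -
    have p0: "params (drop_in L y) w" by (rule params_drop_in [OF p])
    define t where "t = kernel L w C a"
    define t0 where "t0 = kernel (drop_in L y) w C a"
    have vt: "t \<in> vanishing C" and vt0: "t0 \<in> vanishing C"
      using kernel_vanishing p p0 a by (simp_all add: t_def t0_def)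
    have "t0 y = 0" "res L y t = 0"
      using zero [OF p0] zero [OF p] by (simp_all add: t_def t0_def res_drop_in)
    then have "energy L w t0 t = energy (drop_in L y) w t t0"
      unfolding energy_def by (intro sum.cong) (auto simp: res_drop_in)
    then show ?thesis
      using kernel_reproducing [OF p a vt0] kernel_reproducing [OF p0 a vt]
      by (simp add: t_def t0_def)
  qed
  obtain L w where p: "params L w" and r: "res L x (kernel L w C a) \<noteq> 0"
    using rel by (auto simp: relevant_def)
  let ?w = "w(x := w x + 1)"
  have p': "params L ?w" using p by (auto simp: params_def add_pos_pos)
  have "kernel L w C a a \<noteq> kernel L ?w C a a"
    using kernel_weight_update [OF p a yx(2)] r by blast
  moreover have "kernel (drop_in L y) w C a a = kernel (drop_in L y) ?w C a a"
    using kernel_weight_update [OF params_drop_in [OF p] a yx(2)] isolated [OF p] by blast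
  ultimately show False using diag [OF p] diag [OF p'] by simp
qed

text \<open>If y were not linked, no child of y would be relevant, and the edges out of y could be
  dropped with the kernel unchanged. A childless unobserved y has residual 0, so increasing the
  coefficient of the edge from x to y merely adds the value at x to the value at y.\<close>

lemma linked_child:
  assumes a: "a < n" "a \<notin> C" and e: "(x, y) \<in> E" and y: "y \<notin> C" and lnk: "linked C a x"
  shows "linked C a y"
proof (rule ccontr)
  assume nl: "\<not> linked C a y"
  then have zero: "kernel L w C a y = 0" if "params L w" for L w
    using that by (auto simp: linked_def)
  have xy: "x < n" "y < n" "x \<noteq> y" using e edge_bounds no_loop by auto
  obtain L w where p: "params L w" and nz: "kernel L w C a x \<noteq> 0"
    using lnk by (auto simp: linked_def)
  define t where "t = kernel L w C a"
  have vt: "t \<in> vanishing C" using kernel_vanishing p a by (simp add: t_def)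
  have ty: "t y = 0" using zero [OF p] by (simp add: t_def)
  have ya: "a \<noteq> y" using kernel_diag_pos [OF p a] ty by (auto simp: t_def)
  have child: "L y v = 0 \<or> res L v t = 0" for v
  proof (cases "(y, v) \<in> E")
    case True
    then have "\<not> relevant C a v" using linked_parent [OF a True y] nl by blast
    then show ?thesis using p by (auto simp: relevant_def t_def)
  qed (use p in \<open>simp add: params_def\<close>)
  let ?L0 = "drop_out L y"
  have p0: "params ?L0 w" by (rule params_drop_out [OF p])
  have e0: "energy ?L0 w s t = s a" if s: "s \<in> vanishing C" for s
  proof -
    have "energy ?L0 w s t = energy L w s t"
      unfolding energy_def
    proof (intro sum.cong refl)
      fix v
      show "w v * res ?L0 v s * res ?L0 v t = w v * res L v s * res L v t"
        using child [of v] by (auto simp: res_drop_out [OF xy(2)] ty)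
    qed
    then show ?thesis using kernel_reproducing [OF p a s] by (simp add: t_def)
  qed
  have "energy ?L0 w (unit_fun y) t = 0"
    using e0 [OF unit_fun_vanishing [OF xy(2) y]] ya by simp
  moreover have "w y > 0" using p by (simp add: params_def)
  ultimately have r0: "res ?L0 y t = 0"
    using energy_unit_fun [OF p0 xy(2), of t] by (simp add: drop_out_def)
  let ?L1 = "shift_edge ?L0 x y"
  \<comment> \<open>The new kernel: y absorbs the change of its coefficient, so that all residuals
    stay as they were.\<close>
  let ?t1 = "\<lambda>z. t z + t x * unit_fun y z"
  have p1: "params ?L1 w" by (rule params_shift_edge [OF p0 e])
  have rt1: "res ?L1 v ?t1 = res ?L0 v t" for v
    using xy unfolding res_shift_edge [OF xy(1)] res_add res_scale res_unit_fun [OF xy(2)]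
    by (auto simp: drop_out_def shift_edge_def)
  have "energy ?L1 w s ?t1 = s a" if s: "s \<in> vanishing C" for s
  proof -
    have "energy ?L1 w s ?t1 = energy ?L0 w s t"
      unfolding energy_def rt1 by (intro sum.cong) (auto simp: res_shift_edge [OF xy(1)] r0)
    then show ?thesis using e0 [OF s] by simp
  qed
  moreover have "?t1 \<in> vanishing C"
    by (intro vanishing_add vanishing_scale vt unit_fun_vanishing xy y)
  ultimately have "kernel ?L1 w C a = ?t1"
    by (intro kernel_eqI [OF p1]) (simp add: is_kernel_def)
  then have "kernel ?L1 w C a y = t x" by (simp add: ty)
  then show False using zero [OF p1] nz by (simp add: t_def)
qed

text \<open>If the residual at y always vanished, the difference d of the kernels before and after
  perturbing the edge would have residual \<open>- t x\<close> at y, and its energy would equal the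
  summand at y alone. All other residuals of d are then 0, which forces d = 0 since y lies in
  C.\<close>

lemma relevant_observed:
  assumes a: "a < n" "a \<notin> C" and e: "(x, y) \<in> E" and y: "y \<in> C" and lnk: "linked C a x"
  shows "relevant C a y"
proof (rule ccontr)
  assume "\<not> relevant C a y"
  then have zero: "res L y (kernel L w C a) = 0" if "params L w" for L w
    using that by (auto simp: relevant_def)
  have xy: "x < n" "y < n" "x \<noteq> y" using e edge_bounds no_loop by auto
  obtain L w where p: "params L w" and nz: "kernel L w C a x \<noteq> 0"
    using lnk by (auto simp: linked_def)
  let ?L = "shift_edge L x y"
  have p1: "params ?L w" by (rule params_shift_edge [OF p e])
  define t where "t = kernel L w C a"
  define t1 where "t1 = kernel ?L w C a"
  define d where "d = (\<lambda>z. t z - t1 z)"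
  have vt: "t \<in> vanishing C" and vt1: "t1 \<in> vanishing C"
    using kernel_vanishing p p1 a by (simp_all add: t_def t1_def)
  have vd: "d \<in> vanishing C" unfolding d_def by (rule vanishing_diff [OF vt vt1])
  have ry: "res L y t = 0" "res ?L y t1 = 0"
    using zero [OF p] zero [OF p1] by (simp_all add: t_def t1_def)
  then have rd: "res ?L y d = - t x"
    by (simp add: d_def res_diff res_shift_edge [OF xy(1)])
  have "energy ?L w d t = (\<Sum>v<n. w v * res L v d * res L v t + (if v = y then w v * t x * t x else 0))"
    unfolding energy_def
  proof (intro sum.cong refl)
    fix v
    show "w v * res ?L v d * res ?L v t = w v * res L v d * res L v t + (if v = y then w v * t x * t x else 0)"
      using rd ry by (cases "v = y") (auto simp: res_shift_edge [OF xy(1)])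
  qed
  also have "\<dots> = energy L w d t + w y * t x * t x"
    using xy by (simp add: energy_def sum.distrib)
  also have "energy L w d t = d a"
    using kernel_reproducing [OF p a vd] by (simp add: t_def)
  finally have "energy ?L w d t = d a + w y * t x * t x" .
  moreover have "energy ?L w d t1 = d a"
    using kernel_reproducing [OF p1 a vd] by (simp add: t1_def)
  ultimately have "energy ?L w d d = w y * t x * t x"
    by (subst (2) d_def) (simp add: energy_diff_right)
  moreover have "energy ?L w d d = w y * t x * t x + (\<Sum>v\<in>{..<n}-{y}. w v * (res ?L v d * res ?L v d))"
    using xy unfolding energy_def by (subst sum.remove [of _ y]) (simp_all add: rd mult.assoc)
  ultimately have "(\<Sum>v\<in>{..<n}-{y}. w v * (res ?L v d * res ?L v d)) = 0" by simp
  moreover have w: "w v > 0" for v using p by (simp add: params_def)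
  ultimately have "\<forall>v\<in>{..<n}-{y}. w v * (res ?L v d * res ?L v d) = 0"
    by (subst (asm) sum_nonneg_eq_0_iff) (auto simp: less_imp_le [OF w])
  then have "res ?L v d = 0" if "v < n" "v \<notin> C" for v
  proof -
    have "v \<in> {..<n} - {y}" using that y by auto
    then have "w v * (res ?L v d * res ?L v d) = 0"
      using \<open>\<forall>v\<in>{..<n}-{y}. w v * (res ?L v d * res ?L v d) = 0\<close> by blast
    then show ?thesis using w [of v] by simp
  qed
  then have "d = (\<lambda>x. 0)" by (rule res_all_zero [OF p1 vd])
  then show False using rd nz by (simp add: t_def)
qed

text \<open>Being linked travels down the directed walk until it meets C, turns into relevance
  there, and relevance travels back up.\<close>

lemma relevant_collider:
  assumes a: "a < n" "a \<notin> C" and y: "(y, d) \<in> E\<^sup>*" and d: "d \<in> C"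
  shows "(x, y) \<in> E \<Longrightarrow> linked C a x \<Longrightarrow> relevant C a y"
  using y
proof (induction arbitrary: x rule: converse_rtrancl_induct)
  case base
  then show ?case using relevant_observed [OF a] d by blast
next
  case (step y z)
  show ?case
  proof (cases "y \<in> C")
    case True
    then show ?thesis using relevant_observed [OF a] step.prems by blast
  next
    case False
    then have "linked C a y" using linked_child [OF a] step.prems by blast
    then have "relevant C a z" using step by blast
    then show ?thesis using relevant_parent [OF a step.hyps(1) False] by blast
  qed
qed

lemma relevant_self:
  assumes a: "a < n" "a \<notin> C"
  shows "relevant C a a"
proof -
  have p: "params (\<lambda>u v. 0) (\<lambda>v. 1)" by (simp add: params_def)
  have "res (\<lambda>u v. 0) a (kernel (\<lambda>u v. 0) (\<lambda>v. 1) C a) \<noteq> 0"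
    using kernel_diag_pos [OF p a] by (simp add: res_def)
  then show ?thesis using p unfolding relevant_def by blast
qed

lemma linked_self:
  assumes a: "a < n" "a \<notin> C"
  shows "linked C a a"
proof -
  have p: "params (\<lambda>u v. 0) (\<lambda>v. 1)" by (simp add: params_def)
  then show ?thesis using kernel_diag_pos [OF p a] unfolding linked_def by force
qed

text \<open>Leaving a node towards a child uses \<open>linked\<close>, leaving it towards a parent
  uses \<open>relevant\<close>. For a node entered through an arrowhead, relevance is claimed only
  if C meets the node or its descendants, the case in which the collider is open.\<close>

lemma conn_linked_relevant:
  assumes "conn C a x h" and a: "a < n" "a \<notin> C"
  shows "(x \<notin> C \<longrightarrow> linked C a x) \<and>
    (if h then \<forall>d\<in>C. (x, d) \<in> E\<^sup>* \<longrightarrow> relevant C a x else x \<notin> C \<longrightarrow> relevant C a x)"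
  using assms(1)
proof induction
  case start
  show ?case using linked_self relevant_self a by simp
next
  case (forward x h y)
  then show ?case using linked_child [OF a] relevant_collider [OF a] by auto
next
  case (backward x y)
  then show ?case using linked_parent [OF a] relevant_parent [OF a] by auto
next
  case (collider x d y)
  then show ?case using linked_parent [OF a] relevant_parent [OF a] by auto
qed

lemma conn_kernel_nonzero:
  assumes "conn C a b h" "a < n" "a \<notin> C" "b \<notin> C"
  shows "\<exists>L w. params L w \<and> kernel L w C a b \<noteq> 0"
  using conn_linked_relevant [OF assms(1-3)] assms(4) by (simp add: linked_def)

section \<open>Open paths and active walks\<close>

lemma not_blocked_iff:
  "\<not> blocked E C p \<longleftrightarrow> (\<forall>t. 0 < t \<longrightarrow> Suc t < length p \<longrightarrow>
     (if collider_at E p t then \<exists>d\<in>C. (p ! t, d) \<in> E\<^sup>* else p ! t \<notin> C))"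
  unfolding blocked_def rtrancl_eq_or_trancl by auto

lemma open_path_conn:
  assumes path: "is_path E a b p" and op: "\<not> blocked E C p" and a: "a \<notin> C"
  shows "\<exists>h. conn C a b h"
proof -
  \<comment> \<open>At the start \<open>t - 1\<close> truncates to 0, and the conjunct
    \<open>0 < t\<close> makes the flag False.\<close>
  have "conn C a (p ! t) (0 < t \<and> (p ! (t - 1), p ! t) \<in> E)" if "t < length p" for t
    using that
  proof (induction t)
    case 0
    then show ?case using path conn.start by (simp add: is_path_def hd_conv_nth)
  next
    case (Suc t)
    have adj: "adjacent E (p ! t) (p ! Suc t)" using path Suc.prems by (simp add: is_path_def)
    have IH: "conn C a (p ! t) (0 < t \<and> (p ! (t - 1), p ! t) \<in> E)" using Suc by simp
    have ok: "if collider_at E p t then \<exists>d\<in>C. (p ! t, d) \<in> E\<^sup>* else p ! t \<notin> C" if "0 < t"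
      using op that Suc.prems by (simp add: not_blocked_iff)
    have start: "p ! t = a" if "t = 0" using that path by (metis hd_conv_nth is_path_def)
    show ?case
    proof (cases "(p ! t, p ! Suc t) \<in> E")
      case True
      then have "p ! t \<notin> C"
        using ok start a no_two_cycle by (cases "t = 0") (auto simp: collider_at_def)
      then show ?thesis using conn.forward [OF IH _ True] True by simp
    next
      case False
      then have e: "(p ! Suc t, p ! t) \<in> E" using adj by (simp add: adjacent_def)
      have "conn C a (p ! Suc t) False"
      proof (cases "0 < t \<and> (p ! (t - 1), p ! t) \<in> E")
        case True
        then show ?thesis using ok IH e conn.collider by (auto simp: collider_at_def)
      next
        case False
        then have "p ! t \<notin> C" using ok start a by (cases "t = 0") (auto simp: collider_at_def)
        moreover have "conn C a (p ! t) False"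
          using IH False by (metis (full_types))
        ultimately show ?thesis using e conn.backward by blast
      qed
      then show ?thesis using False by simp
    qed
  qed
  moreover have "p \<noteq> []" "last p = b" using path by (simp_all add: is_path_def)
  moreover from this have "length p - 1 < length p" "p ! (length p - 1) = b"
    by (simp_all add: last_conv_nth)
  ultimately show ?thesis by metis
qed

section \<open>From active walks back to open paths\<close>

definition is_walk :: "nat \<Rightarrow> nat \<Rightarrow> nat list \<Rightarrow> bool" where
  "is_walk a b p \<longleftrightarrow> p \<noteq> [] \<and> hd p = a \<and> last p = b \<and>
     (\<forall>t. Suc t < length p \<longrightarrow> adjacent E (p ! t) (p ! Suc t))"

text \<open>Only x becomes a new interior node; \<open>mid\<close> says that it is open, with
  \<open>p ! (length p - 2)\<close> as its predecessor.\<close>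

lemma walk_snoc:
  assumes walk: "is_walk a x p" and op: "\<not> blocked E C p" and adj: "adjacent E x y"
    and mid: "1 < length p \<Longrightarrow> if (p ! (length p - 2), x) \<in> E \<and> (y, x) \<in> E
                then \<exists>d\<in>C. (x, d) \<in> E\<^sup>* else x \<notin> C"
  shows "is_walk a y (p @ [y]) \<and> \<not> blocked E C (p @ [y])"
proof
  have last: "p ! (length p - 1) = x" "p \<noteq> []"
    using walk by (metis is_walk_def last_conv_nth) (use walk in \<open>simp add: is_walk_def\<close>)
  show "is_walk a y (p @ [y])"
    unfolding is_walk_def
  proof (intro conjI allI impI)
    show "hd (p @ [y]) = a" using walk by (simp add: is_walk_def)
    fix t assume "Suc t < length (p @ [y])"
    then show "adjacent E ((p @ [y]) ! t) ((p @ [y]) ! Suc t)"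
      using walk adj last
      by (cases "t = length p - 1") (auto simp: is_walk_def nth_append less_Suc_eq)
  qed simp_all
  show "\<not> blocked E C (p @ [y])"
    unfolding not_blocked_iff
  proof (intro allI impI)
    fix t assume t: "0 < t" "Suc t < length (p @ [y])"
    show "if collider_at E (p @ [y]) t then \<exists>d\<in>C. ((p @ [y]) ! t, d) \<in> E\<^sup>* else (p @ [y]) ! t \<notin> C"
    proof (cases "Suc t = length p")
      case True
      then have "t = length p - 1" "t - 1 = length p - 2" by auto
      then show ?thesis using mid t True last by (auto simp: collider_at_def nth_append)
    next
      case False
      then show ?thesis
        using op t unfolding not_blocked_iff by (auto simp: collider_at_def nth_append)
    qed
  qed
qed

lemma conn_open_walk:
  assumes "conn C a x h"
  shows "\<exists>p. is_walk a x p \<and> \<not> blocked E C p \<and>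
    (h \<longleftrightarrow> 1 < length p \<and> (p ! (length p - 2), x) \<in> E)"
  using assms
proof induction
  case start
  show ?case by (rule exI [of _ "[a]"]) (simp add: is_walk_def blocked_def)
next
  case (forward x h y)
  then obtain p where p: "is_walk a x p" "\<not> blocked E C p" by blast
  have "is_walk a y (p @ [y]) \<and> \<not> blocked E C (p @ [y])"
    using forward no_two_cycle by (intro walk_snoc [OF p]) (auto simp: adjacent_def)
  moreover have "(p @ [y]) ! (length (p @ [y]) - 2) = x" "p \<noteq> []"
    using p(1) by (auto simp: is_walk_def nth_append last_conv_nth)
  ultimately show ?case using forward(3) by (intro exI [of _ "p @ [y]"]) auto
next
  case (backward x y)
  then obtain p where p: "is_walk a x p" "\<not> blocked E C p"
    "\<not> (1 < length p \<and> (p ! (length p - 2), x) \<in> E)" by blast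
  have "is_walk a y (p @ [y]) \<and> \<not> blocked E C (p @ [y])"
    using backward p(3) by (intro walk_snoc [OF p(1,2)]) (auto simp: adjacent_def)
  moreover have "(p @ [y]) ! (length (p @ [y]) - 2) = x" "p \<noteq> []"
    using p(1) by (auto simp: is_walk_def nth_append last_conv_nth)
  ultimately show ?case using backward(3) no_two_cycle by (intro exI [of _ "p @ [y]"]) auto
next
  case (collider x d y)
  then obtain p where p: "is_walk a x p" "\<not> blocked E C p"
    "1 < length p" "(p ! (length p - 2), x) \<in> E" by blast
  have "is_walk a y (p @ [y]) \<and> \<not> blocked E C (p @ [y])"
    using collider p(3,4) by (intro walk_snoc [OF p(1,2)]) (auto simp: adjacent_def)
  moreover have "(p @ [y]) ! (length (p @ [y]) - 2) = x" "p \<noteq> []"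
    using p(1) by (auto simp: is_walk_def nth_append last_conv_nth)
  ultimately show ?case using collider(4) no_two_cycle by (intro exI [of _ "p @ [y]"]) auto
qed

text \<open>If a loop at x is cut out of an open walk and x becomes a collider without having been one,
  then the loop leaves x along a directed walk, which must run into a collider: x has a descendant in C.\<close>

lemma open_walk_loop:
  assumes op: "\<not> blocked E C p" and st: "s < t" "t < length p" "p ! s = p ! t"
    and e: "(p ! s, p ! Suc s) \<in> E"
    and walk: "\<And>k. Suc k < length p \<Longrightarrow> adjacent E (p ! k) (p ! Suc k)"
  shows "\<exists>d\<in>C. (p ! s, d) \<in> E\<^sup>*"
proof (rule ccontr)
  assume no: "\<not> (\<exists>d\<in>C. (p ! s, d) \<in> E\<^sup>*)"
  have "k < t \<longrightarrow> (p ! k, p ! Suc k) \<in> E \<and> (p ! s, p ! Suc k) \<in> E\<^sup>+" if "s \<le> k" for k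
    using that
  proof (induction k rule: dec_induct)
    case base
    then show ?case using e by auto
  next
    case (step k)
    show ?case
    proof
      assume k: "Suc k < t"
      then have IH: "(p ! k, p ! Suc k) \<in> E" "(p ! s, p ! Suc k) \<in> E\<^sup>+" using step by auto
      have "(p ! Suc (Suc k), p ! Suc k) \<notin> E"
      proof
        assume "(p ! Suc (Suc k), p ! Suc k) \<in> E"
        then have "collider_at E p (Suc k)" using IH(1) by (simp add: collider_at_def)
        then have "\<exists>d\<in>C. (p ! Suc k, d) \<in> E\<^sup>*"
          using op k st(2) unfolding not_blocked_iff by (metis Suc_lessI less_trans zero_less_Suc less_SucI Suc_less_eq)
        then show False using no IH(2) by (meson rtrancl_trans trancl_into_rtrancl)
      qed
      then have "(p ! Suc k, p ! Suc (Suc k)) \<in> E"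
        using walk [of "Suc k"] k st(2) by (auto simp: adjacent_def)
      then show "(p ! Suc k, p ! Suc (Suc k)) \<in> E \<and> (p ! s, p ! Suc (Suc k)) \<in> E\<^sup>+"
        using IH(2) by (meson trancl.trancl_into_trancl)
    qed
  qed
  from this [of "t - 1"] have "(p ! s, p ! t) \<in> E\<^sup>+" using st(1) by auto
  then show False using st(3) acyclic_E by (simp add: acyclic_def)
qed

text \<open>Only \<open>p ! s\<close> gets new neighbours, \<open>p ! (s - 1)\<close> and
  \<open>p ! Suc t\<close>. If it is now a non-collider, it was one at s or at t, hence lies outside
  C. If it is now a collider, it was one at s, or the loop leaves it along an outgoing edge and
  \<open>open_walk_loop\<close> applies.\<close>

lemma open_walk_shorten:
  assumes walk: "is_walk a b p" and op: "\<not> blocked E C p"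
    and st: "s < t" "t < length p" "p ! s = p ! t"
  shows "is_walk a b (take s p @ drop t p) \<and> \<not> blocked E C (take s p @ drop t p)"
proof
  let ?q = "take s p @ drop t p"
  have lo: "?q ! k = p ! k" if "k \<le> s" for k
    using that st by (cases "k = s") (auto simp: nth_append)
  have hi: "?q ! k = p ! (k + (t - s))" if "s \<le> k" "k < length ?q" for k
    using that st by (auto simp: nth_append add.commute)
  have len: "length ?q = length p - (t - s)" using st by auto
  have adj: "adjacent E (p ! k) (p ! Suc k)" if "Suc k < length p" for k
    using walk that by (simp add: is_walk_def)
  have ok: "if collider_at E p k then \<exists>d\<in>C. (p ! k, d) \<in> E\<^sup>* else p ! k \<notin> C"
    if "0 < k" "Suc k < length p" for k
    using op that unfolding not_blocked_iff by blast
  show "is_walk a b ?q"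
    unfolding is_walk_def
  proof (intro conjI allI impI)
    show "?q \<noteq> []" using st by simp
    have "hd ?q = ?q ! 0" using st by (simp add: hd_conv_nth del: hd_append2)
    then show "hd ?q = a" using lo [of 0] walk by (auto simp: is_walk_def hd_conv_nth)
    show "last ?q = b" using st walk by (simp add: is_walk_def)
    fix k assume k: "Suc k < length ?q"
    show "adjacent E (?q ! k) (?q ! Suc k)"
    proof (cases "k < s")
      case True
      then show ?thesis using lo [of k] lo [of "Suc k"] adj [of k] st by simp
    next
      case False
      then show ?thesis using hi [of k] hi [of "Suc k"] adj [of "k + (t - s)"] st k len by simp
    qed
  qed
  show "\<not> blocked E C ?q"
    unfolding not_blocked_iff
  proof (intro allI impI)
    fix k assume k: "0 < k" "Suc k < length ?q"
    consider "k < s" | "s < k" | "k = s" by linarith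
    then show "if collider_at E ?q k then \<exists>d\<in>C. (?q ! k, d) \<in> E\<^sup>* else ?q ! k \<notin> C"
    proof cases
      case 1
      then have "?q ! (k - 1) = p ! (k - 1)" "?q ! k = p ! k" "?q ! Suc k = p ! Suc k"
        by (auto intro!: lo)
      then show ?thesis using ok [of k] k 1 st by (simp add: collider_at_def)
    next
      case 2
      then have "s \<le> k - 1" "k - 1 < length ?q" "s \<le> k" "k < length ?q" "s \<le> Suc k" "Suc k < length ?q"
        using k by linarith+
      then have "?q ! (k - 1) = p ! (k - 1 + (t - s))" "?q ! k = p ! (k + (t - s))"
        "?q ! Suc k = p ! (Suc k + (t - s))"
        by (blast intro: hi)+
      moreover have "k - 1 + (t - s) = k + (t - s) - 1" using k by simp
      moreover have "0 < k + (t - s)" "Suc (k + (t - s)) < length p" using k len st by linarith+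
      ultimately show ?thesis using ok [of "k + (t - s)"] by (simp add: collider_at_def del: diff_diff_left)
    next
      case 3
      have q: "?q ! (k - 1) = p ! (s - 1)" "?q ! k = p ! s" "?q ! Suc k = p ! Suc t"
        using lo [of "k - 1"] lo [of k] hi [of "Suc k"] 3 k st by (auto simp del: length_append)
      have t: "Suc t < length p" using k 3 len st by linarith
      have s: "0 < s" "Suc s < length p" using k 3 st by linarith+
      show ?thesis
      proof (cases "collider_at E p s")
        case True
        then have "\<exists>d\<in>C. (p ! s, d) \<in> E\<^sup>*" using ok [OF s] by simp
        moreover have "p ! s \<notin> C" if "\<not> collider_at E ?q k"
        proof -
          have "(p ! Suc t, p ! t) \<notin> E"
            using that True q st 3 by (auto simp: collider_at_def)
          then have "\<not> collider_at E p t" by (simp add: collider_at_def)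
          then show ?thesis using ok [of t] t st by simp
        qed
        ultimately show ?thesis using q by simp
      next
        case False
        then have "p ! s \<notin> C" using ok [OF s] by simp
        moreover have "\<exists>d\<in>C. (p ! s, d) \<in> E\<^sup>*" if "collider_at E ?q k"
        proof -
          have "(p ! Suc s, p ! s) \<notin> E" using False that q by (auto simp: collider_at_def)
          then have "(p ! s, p ! Suc s) \<in> E" using adj [OF s(2)] by (simp add: adjacent_def)
          then show ?thesis by (rule open_walk_loop [OF op st]) (rule adj)
        qed
        ultimately show ?thesis using q by simp
      qed
    qed
  qed
qed

lemma open_walk_path:
  assumes "is_walk a b p" "\<not> blocked E C p"
  shows "\<exists>q. is_path E a b q \<and> \<not> blocked E C q"
  using assms
proof (induction "length p" arbitrary: p rule: less_induct)
  case less
  show ?case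
  proof (cases "distinct p")
    case True
    then show ?thesis using less.prems by (auto simp: is_walk_def is_path_def)
  next
    case False
    then obtain s t where "s < t" "t < length p" "p ! s = p ! t"
      by (metis distinct_conv_nth linorder_neq_iff)
    then show ?thesis using open_walk_shorten [OF less.prems]
      by (intro less.hyps [of "take s p @ drop t p"]) auto
  qed
qed

lemma d_separates_iff:
  assumes "a \<notin> C"
  shows "d_separates E C a b \<longleftrightarrow> \<not> (\<exists>h. conn C a b h)"
  unfolding d_separates_def
  using open_path_conn [OF _ _ assms] conn_open_walk open_walk_path by blast

section \<open>Markov property\<close>

text \<open>Nodes that are not ancestors of a or C can be marginalized out. By induction from the
  sinks, the children contribute 0 to the reproducing identity for the unit function at v, which
  leaves only the residual at v.\<close>

lemma res_kernel_nonancestor: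
  assumes p: "params L w" and a: "a < n" "a \<notin> C"
  shows "v < n \<Longrightarrow> \<forall>d\<in>insert a C. (v, d) \<notin> E\<^sup>* \<Longrightarrow> res L v (kernel L w C a) = 0"
proof (induction v rule: wf_induct_rule [OF wf_E_converse])
  case (1 v)
  let ?t = "kernel L w C a"
  have v: "v \<notin> C" "v \<noteq> a" using 1(3) by auto
  have "L v c * w c * res L c ?t = 0" if "c < n" for c
  proof (cases "(v, c) \<in> E")
    case True
    then have "\<forall>d\<in>insert a C. (c, d) \<notin> E\<^sup>*" using 1(3) by (meson converse_rtrancl_into_rtrancl)
    then show ?thesis using 1(1) [of c] True that by simp
  qed (use p in \<open>simp add: params_def\<close>)
  then have "(\<Sum>c<n. L v c * w c * res L c ?t) = 0" by (intro sum.neutral) simp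
  moreover have "energy L w (unit_fun v) ?t = 0"
    using kernel_reproducing [OF p a unit_fun_vanishing [OF 1(2) v(1)]] v by simp
  moreover have "w v > 0" using p by (simp add: params_def)
  ultimately show ?case using energy_unit_fun [OF p 1(2), of ?t] by simp
qed

lemma conn_descend:
  assumes "conn C a x h" "(x, y) \<in> E\<^sup>*" "\<forall>d\<in>C. (x, d) \<notin> E\<^sup>*"
  shows "\<exists>h. conn C a y h"
  using assms(2)
proof (induction rule: rtrancl_induct)
  case base
  then show ?case using assms(1) by blast
next
  case (step y z)
  then have "y \<notin> C" using assms(3) by blast
  then show ?case using step conn.forward by blast
qed

lemma conn_ascend:
  assumes "(x, a) \<in> E\<^sup>*"
  shows "\<forall>d\<in>C. (x, d) \<notin> E\<^sup>* \<Longrightarrow> conn C a x False"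
  using assms
proof (induction rule: converse_rtrancl_induct)
  case base
  show ?case by (rule conn.start)
next
  case (step x z)
  then have "\<forall>d\<in>C. (z, d) \<notin> E\<^sup>*" by (meson converse_rtrancl_into_rtrancl)
  then show ?case using step conn.backward by blast
qed

text \<open>Among the ancestors of a, b and C, being connected to a passes from a node to its parents even
  through a collider that is not opened by C: such a collider leads down to b, or up from a.\<close>

lemma conn_parent:
  assumes b: "\<not> (\<exists>h. conn C a b h)"
    and x: "conn C a x h" "h \<or> x \<notin> C"
    and anc: "\<exists>d\<in>insert a (insert b C). (x, d) \<in> E\<^sup>*" and e: "(y, x) \<in> E"
  shows "conn C a y False"
proof (cases "\<exists>d\<in>C. (x, d) \<in> E\<^sup>*")
  case True
  then show ?thesis using x e by (cases h) (auto intro: conn.collider conn.backward)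
next
  case False
  then have "(x, a) \<in> E\<^sup>* \<or> (x, b) \<in> E\<^sup>*" using anc by blast
  moreover have "(x, b) \<notin> E\<^sup>*" using conn_descend [OF x(1)] False b by blast
  ultimately have "conn C a x False" using conn_ascend False by blast
  moreover have "x \<notin> C" using False by blast
  ultimately show ?thesis using e conn.backward by blast
qed

text \<open>Off C, the family of v (v and its parents) lies entirely inside or entirely outside X,
  so truncation to X keeps the residual or kills it.\<close>

lemma res_restrict:
  assumes p: "params L w" and t: "t \<in> vanishing C"
    and fam: "\<And>x. x \<notin> C \<Longrightarrow> x = v \<or> (x, v) \<in> E \<Longrightarrow> x \<in> X \<longleftrightarrow> inX"
  shows "res L v (\<lambda>x. if x \<in> X then t x else 0) = (if inX then res L v t else 0)"
proof -
  have nz: "L u v * (if u \<in> X then t u else 0) = (if inX then L u v * t u else 0)" for u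
  proof (cases "(u, v) \<in> E \<and> u \<notin> C")
    case True
    then show ?thesis using fam [of u] by auto
  qed (use p t in \<open>auto simp: params_def vanishing_def\<close>)
  have "(if v \<in> X then t v else 0) = (if inX then t v else 0)"
    using fam [of v] t by (cases "v \<in> C") (auto simp: vanishing_def)
  then show ?thesis unfolding res_def nz by (cases inX) simp_all
qed

text \<open>X plays the role of the component of a in the moral graph of the ancestral set A with C
  removed. Truncation to X can be moved from one argument of the energy to the other; applied to the
  kernels at a and b this equates the value of g at a with 0, because a is in X and b is
  not.\<close>

lemma kernel_markov:
  assumes p: "params L w" and a: "a < n" "a \<notin> C" and b: "b < n" "b \<notin> C"
    and sep: "\<not> (\<exists>h. conn C a b h)"
  shows "kernel L w C a b = 0"
proof -
  define A where "A = {x. \<exists>d\<in>insert a (insert b C). (x, d) \<in> E\<^sup>*}"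
  define X where "X = {x \<in> A. x \<notin> C \<and> (\<exists>h. conn C a x h)}"
  have up: "y \<in> A" if "(y, x) \<in> E" "x \<in> A" for x y
    using that unfolding A_def by (auto intro: converse_rtrancl_into_rtrancl)
  have family: "x \<in> X \<longleftrightarrow> y \<in> X"
    if v: "v \<in> A" and x: "x \<notin> C" "x = v \<or> (x, v) \<in> E" and y: "y \<notin> C" "y = v \<or> (y, v) \<in> E" for v x y
  proof -
    have "y \<in> X" if v: "v \<in> A" and x: "x = v \<or> (x, v) \<in> E" "x \<in> X"
      and y: "y \<notin> C" "y = v \<or> (y, v) \<in> E" for x y
    proof (cases "y = x")
      case False
      obtain h where h: "conn C a x h" "x \<notin> C" using x by (auto simp: X_def)
      show ?thesis
      proof (cases "x = v")
        case True
        then show ?thesis using False h y conn_parent [OF sep h(1)] up [of y v] v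
          by (auto simp: X_def A_def)
      next
        case v': False
        then have "conn C a v True" using conn.forward [OF h] x by blast
        then show ?thesis using y conn_parent [OF sep, of v True y] up [of y v] v
          by (auto simp: X_def A_def)
      qed
    qed (use x in simp)
    then show ?thesis using that by blast
  qed
  define t where "t = kernel L w C a"
  define g where "g = kernel L w C b"
  have vt: "t \<in> vanishing C" and vg: "g \<in> vanishing C"
    using kernel_vanishing p a b by (simp_all add: t_def g_def)
  let ?r = "\<lambda>f x. if x \<in> X then f x else (0::real)"
  have vr: "?r t \<in> vanishing C" "?r g \<in> vanishing C"
    using vt vg by (auto simp: vanishing_def)
  have "energy L w (?r g) t = energy L w g (?r t)"
    unfolding energy_def
  proof (intro sum.cong refl)
    fix v assume "v \<in> {..<n}"
    show "w v * res L v (?r g) * res L v t = w v * res L v g * res L v (?r t)"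
    proof (cases "v \<in> A")
      case True
      define inX where "inX \<longleftrightarrow> (\<exists>x. x \<notin> C \<and> (x = v \<or> (x, v) \<in> E) \<and> x \<in> X)"
      have "x \<in> X \<longleftrightarrow> inX" if "x \<notin> C" "x = v \<or> (x, v) \<in> E" for x
        unfolding inX_def using family [OF True that] that by blast
      then have "res L v (?r f) = (if inX then res L v f else 0)" if "f \<in> vanishing C" for f
        using res_restrict [OF p that] by blast
      then show ?thesis using vt vg by simp
    next
      case False
      \<comment> \<open>Outside the ancestral set a family may mix X with its complement, but there
        both kernels have residual 0.\<close>
      then have "res L v t = 0" "res L v g = 0"
        using res_kernel_nonancestor [OF p] a b \<open>v \<in> {..<n}\<close> by (auto simp: A_def t_def g_def)
      then show ?thesis by simp
    qed
  qed
  moreover have "energy L w (?r g) t = ?r g a"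
    using kernel_reproducing [OF p a vr(2)] by (simp add: t_def)
  moreover have "energy L w g (?r t) = ?r t b"
    using kernel_reproducing [OF p b vr(1)] by (simp add: g_def energy_commute)
  moreover have "a \<in> X" using a conn.start by (auto simp: X_def A_def)
  moreover have "b \<notin> X" using sep by (simp add: X_def)
  ultimately have "g a = 0" by simp
  then show ?thesis using kernel_symmetric [OF p a b] by (simp add: g_def)
qed

section \<open>Conditioning on one more variable\<close>

text \<open>The recursion for conditional covariances: subtracting the multiple of the kernel at j
  that cancels the value at j preserves the reproducing identity on functions that also vanish at
  j.\<close>

lemma kernel_insert:
  assumes p: "params L w" and j: "j < n" "j \<notin> K" and a: "a < n" "a \<notin> K" "a \<noteq> j"
  shows "kernel L w K a x = kernel L w (insert j K) a x
    + kernel L w K a j / kernel L w K j j * kernel L w K j x"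
proof -
  define c where "c = kernel L w K a j / kernel L w K j j"
  let ?U = "\<lambda>x. kernel L w K a x - c * kernel L w K j x"
  have v: "kernel L w K a \<in> vanishing K" "kernel L w K j \<in> vanishing K"
    using kernel_vanishing p j a by simp_all
  have "?U j = 0" using kernel_diag_pos [OF p j] by (simp add: c_def)
  then have "?U \<in> vanishing (insert j K)"
    using vanishing_diff [OF v(1) vanishing_scale [OF v(2)], of c] by (auto simp: vanishing_def)
  moreover have "energy L w s ?U = s a" if s: "s \<in> vanishing (insert j K)" for s
  proof -
    have "s \<in> vanishing K" "s j = 0" using s by (auto simp: vanishing_def)
    then show ?thesis
      using kernel_reproducing [OF p a(1,2)] kernel_reproducing [OF p j]
      by (simp add: energy_diff_right energy_scale_right)
  qed
  ultimately have "kernel L w (insert j K) a = ?U"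
    by (intro kernel_eqI [OF p]) (simp add: is_kernel_def)
  then show ?thesis by (simp add: c_def)
qed

text \<open>The kernel at j, normalized to 1 at j, is orthogonal to T because T vanishes at j;
  subtracting the unit function at j makes it a test function for T. The formula is affine in the
  coefficients of the edges out of j, since T and its residuals do not depend on them.\<close>

lemma kernel_regression:
  assumes p: "params L w" and j: "j < n" "j \<notin> K" and a: "a < n" "a \<notin> K" "a \<noteq> j"
  defines "T \<equiv> kernel L w (insert j K) a"
  shows "kernel L w K a j / kernel L w K j j = (\<Sum>v<n. L j v * w v * res L v T) - w j * res L j T"
proof -
  have a': "a \<notin> insert j K" using a by simp
  have vT: "T \<in> vanishing (insert j K)" unfolding T_def by (rule kernel_vanishing [OF p a(1) a'])
  have vT': "T \<in> vanishing K" by (rule vanishing_mono [OF _ vT]) auto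
  define f where "f x = 1 / kernel L w K j j * kernel L w K j x" for x
  have "f j = 1" using kernel_diag_pos [OF p j] by (simp add: f_def)
  then have vf: "(\<lambda>x. f x - unit_fun j x) \<in> vanishing (insert j K)"
    using kernel_vanishing [OF p j] by (auto simp: vanishing_def f_def j)
  have "energy L w f T = 1 / kernel L w K j j * energy L w (kernel L w K j) T"
    unfolding f_def by (rule energy_scale)
  also have "energy L w (kernel L w K j) T = T j"
    using kernel_reproducing [OF p j vT'] by (simp add: energy_commute)
  also have "T j = 0" using vT by (simp add: vanishing_def)
  finally have "energy L w f T = 0" by simp
  moreover have "energy L w (\<lambda>x. f x - unit_fun j x) T = f a"
    unfolding T_def using kernel_reproducing [OF p a(1) a' vf] a by simp
  ultimately have "f a = - energy L w (unit_fun j) T" by (simp add: energy_diff)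
  then show ?thesis
    using energy_unit_fun [OF p j(1), of T] kernel_symmetric [OF p a(1,2) j] by (simp add: f_def)
qed

section \<open>Varying the coefficients of the edges out of j\<close>

lemma res_row_irrelevant:
  assumes "t j = 0" "\<And>u. u \<noteq> j \<Longrightarrow> L' u v = L u v"
  shows "res L' v t = res L v t"
proof -
  have *: "L' u v * t u = L u v * t u" for u using assms by (cases "u = j") auto
  show ?thesis by (simp only: res_def *)
qed

lemma kernel_row_irrelevant:
  assumes p: "params L w" and p': "params L' w" and a: "a < n" "a \<notin> insert j K"
    and eq: "\<And>u v. u \<noteq> j \<Longrightarrow> L' u v = L u v"
  shows "kernel L' w (insert j K) a = kernel L w (insert j K) a"
proof (rule kernel_eqI [OF p'])
  let ?T = "kernel L w (insert j K) a"
  have vT: "?T \<in> vanishing (insert j K)" by (rule kernel_vanishing [OF p a])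
  have "energy L' w s ?T = energy L w s ?T" if "s \<in> vanishing (insert j K)" for s
    unfolding energy_def
    using that vT by (intro sum.cong) (auto simp: vanishing_def res_row_irrelevant [of _ j L' _ L] eq)
  then show "is_kernel L' w (insert j K) a ?T"
    unfolding is_kernel_def using vT kernel_reproducing [OF p a] by simp
qed

text \<open>Orthogonality characterizes f as the function of least energy with value 1 at j. It is a
  multiple of the kernel at j, and its energy is the reciprocal of the conditional variance of
  j.\<close>

lemma kernel_via_regression:
  assumes p: "params L w" and j: "j < n" "j \<notin> K"
    and f: "f \<in> vanishing K" "f j = 1"
    and orth: "\<And>s. s \<in> vanishing (insert j K) \<Longrightarrow> energy L w s f = 0"
  shows "energy L w f f > 0" "kernel L w K j x = f x / energy L w f f"
proof -
  have "energy L w f f \<noteq> 0" using energy_definite [OF p f(1)] f(2) by (auto simp: fun_eq_iff)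
  then show pos: "energy L w f f > 0" using energy_nonneg [OF p, of f] by simp
  let ?t = "\<lambda>x. 1 / energy L w f f * f x"
  have "energy L w s ?t = s j" if s: "s \<in> vanishing K" for s
  proof -
    have "(\<lambda>x. s x - s j * f x) \<in> vanishing (insert j K)"
      using s f by (auto simp: vanishing_def)
    then have "energy L w (\<lambda>x. s x - s j * f x) f = 0" by (rule orth)
    then have "energy L w s f = s j * energy L w f f" by (simp add: energy_diff energy_scale)
    then show ?thesis using pos unfolding energy_scale_right by simp
  qed
  then have "kernel L w K j = ?t"
    using vanishing_scale [OF f(1)] by (intro kernel_eqI [OF p]) (simp only: is_kernel_def, blast)
  then show "kernel L w K j x = f x / energy L w f f" by simp
qed

text \<open>Averaging the bounds at h and -h removes the linear term. The chosen h satisfies h >= 1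
  and \<gamma> h = \<gamma> + |M - \<alpha>|, so that \<gamma> h^2 exceeds M - \<alpha>.\<close>

lemma bounded_quadratic:
  fixes \<alpha> \<beta> \<gamma> M :: real
  assumes "\<And>h. \<alpha> + 2 * h * \<beta> + h\<^sup>2 * \<gamma> \<le> M" "\<gamma> \<ge> 0"
  shows "\<gamma> = 0"
proof (rule ccontr)
  assume "\<gamma> \<noteq> 0"
  then have pos: "\<gamma> > 0" using assms(2) by simp
  define h where "h = 1 + \<bar>M - \<alpha>\<bar> / \<gamma>"
  have h: "h \<ge> 1" using pos by (simp add: h_def)
  have "\<gamma> * h = \<gamma> + \<bar>M - \<alpha>\<bar>" using pos by (simp add: h_def field_simps)
  moreover have "\<gamma> * h \<le> \<gamma> * h\<^sup>2"
    using h pos by (simp add: power2_eq_square)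
  moreover have "\<alpha> + h\<^sup>2 * \<gamma> \<le> M" using assms(1) [of h] assms(1) [of "- h"] by simp
  ultimately show False using pos by (simp add: mult.commute)
qed

text \<open>Along the ray that scales the edges out of j, the reciprocal of the conditional variance of j is
  a quadratic polynomial.\<close>

lemma kernel_drop_out_of_bounded:
  assumes p: "params L w" and j: "j < n" "j \<notin> K"
    and bound: "\<And>h. 1 / kernel (L(j := (\<lambda>v. h * L j v))) w K j j \<le> M"
  shows "kernel (drop_out L j) w K j j = kernel L w K j j"
proof -
  define Lh where "Lh h = L(j := (\<lambda>v. h * L j v))" for h :: real
  have ph: "params (Lh h) w" for h using p by (auto simp: params_def Lh_def)
  define f where "f h x = kernel (Lh h) w K j x / kernel (Lh h) w K j j" for h x
  have vf: "f h \<in> vanishing K" and fj: "f h j = 1" for h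
    using kernel_vanishing [OF ph j, of h] kernel_diag_pos [OF ph j, of h]
    by (auto simp: f_def vanishing_def)
  have f_eq: "f h = (\<lambda>x. 1 / kernel (Lh h) w K j j * kernel (Lh h) w K j x)" for h
    by (simp add: f_def fun_eq_iff)
  have orth: "energy (Lh h) w s (f h) = 0" if "s \<in> vanishing (insert j K)" for s h
    unfolding f_eq energy_scale_right
    using kernel_reproducing [OF ph j vanishing_mono [OF subset_insertI that]] that
    by (simp add: vanishing_def)
  \<comment> \<open>The orthogonality conditions on the regression function are linear, with a
    right-hand side linear in h. Hence interpolating the solutions for h = 0 and h = 1 solves them
    for every h.\<close>
  define g where "g h x = (1 - h) * f 0 x + h * f 1 x" for h x
  have g_eq: "g h = (\<lambda>x. (1 - h) * f 0 x + h * f 1 x)" for h by (simp add: g_def fun_eq_iff)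
  have vg: "g h \<in> vanishing K" and gj: "g h j = 1" for h
    using vf [of 0] vf [of 1] fj by (auto simp: g_def vanishing_def)
  have res_h: "res (Lh h) v t = res (Lh 0) v t - h * L j v * t j" for h v t
  proof -
    have "(\<Sum>u<n. Lh h u v * t u) = (\<Sum>u<n. Lh 0 u v * t u + (if u = j then h * L j v * t u else 0))"
      by (intro sum.cong) (auto simp: Lh_def)
    then show ?thesis using j by (simp add: res_def sum.distrib)
  qed
  have res_g: "res (Lh h) v (g h) = (1 - h) * res (Lh 0) v (f 0) + h * res (Lh 1) v (f 1)" for h v
    unfolding res_h [of h] res_h [of 1] gj fj
    unfolding g_eq res_add res_scale by (simp add: algebra_simps)
  have orth_g: "energy (Lh h) w s (g h) = 0" if s: "s \<in> vanishing (insert j K)" for s h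
  proof -
    have rs: "res (Lh h) v s = res (Lh 0) v s" for h v using s res_h [of h v s] by (simp add: vanishing_def)
    then have "energy (Lh h) w s (g h) = (1 - h) * energy (Lh 0) w s (f 0) + h * energy (Lh 1) w s (f 1)"
      unfolding energy_def res_g rs [of h] rs [of 1]
      by (simp add: sum_distrib_left sum.distrib [symmetric] algebra_simps)
    then show ?thesis using orth [OF s] by simp
  qed
  \<comment> \<open>The residual of \<open>g h\<close> at v is \<open>A v + h * D v\<close>; the
    energy of \<open>g h\<close> is therefore quadratic in h, with leading coefficient the weighted
    sum of squares of D.\<close>
  define A where "A v = res (Lh 0) v (f 0)" for v
  define D where "D v = res (Lh 1) v (f 1) - res (Lh 0) v (f 0)" for v
  have var: "1 / kernel (Lh h) w K j j = energy (Lh h) w (g h) (g h)" for h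
    using kernel_via_regression(2) [OF ph j vg gj orth_g, of h j] gj [of h] by simp
  have quad: "energy (Lh h) w (g h) (g h)
      = (\<Sum>v<n. w v * A v * A v) + 2 * h * (\<Sum>v<n. w v * A v * D v) + h\<^sup>2 * (\<Sum>v<n. w v * D v * D v)" for h
    unfolding energy_def res_g A_def D_def
    by (simp add: sum_distrib_left sum.distrib [symmetric] power2_eq_square algebra_simps)
  have w: "w v > 0" for v using p by (simp add: params_def)
  have nonneg: "w v * D v * D v \<ge> 0" for v using w [of v] by (simp add: mult.assoc)
  have "(\<Sum>v<n. w v * D v * D v) = 0"
  proof (rule bounded_quadratic)
    show "(\<Sum>v<n. w v * A v * A v) + 2 * h * (\<Sum>v<n. w v * A v * D v)
        + h\<^sup>2 * (\<Sum>v<n. w v * D v * D v) \<le> M" for h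
      using bound [of h] var [of h] quad [of h] by (simp add: Lh_def)
    show "(\<Sum>v<n. w v * D v * D v) \<ge> 0" by (intro sum_nonneg nonneg)
  qed
  then have "\<forall>v\<in>{..<n}. w v * D v * D v = 0"
    by (subst (asm) sum_nonneg_eq_0_iff) (use nonneg in auto)
  then have "D v = 0" if "v < n" for v using that w [of v] by (metis lessThan_iff less_irrefl mult_eq_0_iff)
  then have "energy (Lh 1) w (g 1) (g 1) = energy (Lh 0) w (g 0) (g 0)"
    unfolding quad by simp
  then have "kernel (Lh 1) w K j j = kernel (Lh 0) w K j j"
    using var [of 0] var [of 1] by (metis divide_cancel_left one_neq_zero)
  moreover have "Lh 1 = L" "Lh 0 = drop_out L j" by (auto simp: Lh_def drop_out_def fun_eq_iff)
  ultimately show ?thesis by simp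
qed

text \<open>Once j has no children, the kernel at a has residual 0 at j and no other residual
  involves its value at j. Deleting the edges into j then only resets that value to 0.\<close>

lemma kernel_isolate:
  assumes p: "params L w" and j: "j < n" "j \<notin> K" and a: "a < n" "a \<notin> K" "a \<noteq> j"
  shows "kernel (drop_in (drop_out L j) j) w K a
    = (\<lambda>x. if x = j then 0 else kernel (drop_out L j) w K a x)"
proof (rule kernel_eqI)
  let ?L0 = "drop_out L j"
  let ?L1 = "drop_in ?L0 j"
  define t where "t = kernel ?L0 w K a"
  let ?t' = "\<lambda>x. if x = j then 0 else t x"
  have p0: "params ?L0 w" by (rule params_drop_out [OF p])
  show "params ?L1 w" by (rule params_drop_in [OF p0])
  have vt: "t \<in> vanishing K" unfolding t_def by (rule kernel_vanishing [OF p0 a(1,2)])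
  have "energy ?L0 w (unit_fun j) t = 0"
    using kernel_reproducing [OF p0 a(1,2) unit_fun_vanishing [OF j]] a by (simp add: t_def)
  moreover have "w j > 0" using p by (simp add: params_def)
  ultimately have r: "res ?L0 j t = 0"
    using energy_unit_fun [OF p0 j(1), of t] by (simp add: drop_out_def)
  have *: "?L0 u v * ?t' u = ?L0 u v * t u" for u v by (simp add: drop_out_def)
  have "res ?L0 v ?t' = res ?L0 v t" if "v \<noteq> j" for v
    unfolding res_def * using that by simp
  then have r': "res ?L1 v ?t' = res ?L0 v t" for v
    using r by (simp add: res_drop_in)
  have "energy ?L1 w s ?t' = s a" if s: "s \<in> vanishing K" for s
  proof -
    have "energy ?L1 w s ?t' = energy ?L0 w s t"
      unfolding energy_def r' by (intro sum.cong) (auto simp: r res_drop_in)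
    then show ?thesis using kernel_reproducing [OF p0 a(1,2) s] by (simp add: t_def)
  qed
  then show "is_kernel ?L1 w K a (\<lambda>x. if x = j then 0 else kernel ?L0 w K a x)"
    unfolding is_kernel_def t_def [symmetric] using vt by (auto simp: vanishing_def)
qed

lemma regression_shift:
  fixes h :: real
  assumes p: "params L w" and j: "j < n" "j \<notin> K" and a: "a < n" "a \<notin> K" "a \<noteq> j" and e: "(j, c) \<in> E"
  defines "L' \<equiv> L(j := (L j)(c := L j c + h))"
  shows "kernel L' w K a j / kernel L' w K j j
    = kernel L w K a j / kernel L w K j j + h * w c * res L c (kernel L w (insert j K) a)"
proof -
  let ?T = "kernel L w (insert j K) a"
  have a': "a < n" "a \<notin> insert j K" using a by auto
  have p': "params L' w" using p e by (auto simp: params_def L'_def)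
  have eq: "L' u v = L u v" if "u \<noteq> j" for u v using that by (simp add: L'_def)
  have T: "kernel L' w (insert j K) a = ?T" by (rule kernel_row_irrelevant [OF p p' a' eq])
  have "?T j = 0" using kernel_vanishing [OF p a'] by (simp add: vanishing_def)
  then have R: "res L' v ?T = res L v ?T" for v by (rule res_row_irrelevant) (rule eq)
  have c: "c < n" "c \<noteq> j" using e edge_bounds no_loop by auto
  have "(\<Sum>v<n. L' j v * w v * res L v ?T)
      = (\<Sum>v<n. L j v * w v * res L v ?T + (if v = c then h * w v * res L v ?T else 0))"
    by (intro sum.cong) (auto simp: L'_def algebra_simps)
  also have "\<dots> = (\<Sum>v<n. L j v * w v * res L v ?T) + h * w c * res L c ?T"
    using c by (simp add: sum.distrib)
  finally show ?thesis
    unfolding kernel_regression [OF p j a] kernel_regression [OF p' j a] T R by simp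
qed

lemma regression_no_children:
  assumes p: "params L w" and j: "j < n" "j \<notin> K" and a: "a < n" "a \<notin> K" "a \<noteq> j"
    and p': "params L' w" and eq: "\<And>u v. u \<noteq> j \<Longrightarrow> L' u v = L u v"
    and irr: "\<And>c. (j, c) \<in> E \<Longrightarrow> res L c (kernel L w (insert j K) a) = 0"
  shows "kernel L' w K a j / kernel L' w K j j = kernel L w K a j / kernel L w K j j"
proof -
  let ?T = "kernel L w (insert j K) a"
  have a': "a < n" "a \<notin> insert j K" using a by auto
  have T: "kernel L' w (insert j K) a = ?T" by (rule kernel_row_irrelevant [OF p p' a' eq])
  have "?T j = 0" using kernel_vanishing [OF p a'] by (simp add: vanishing_def)
  then have R: "res L' v ?T = res L v ?T" for v by (rule res_row_irrelevant) (rule eq)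
  have *: "L' j v * w v * res L v ?T = 0" "L j v * w v * res L v ?T = 0" for v
    using irr [of v] p p' by (cases "(j, v) \<in> E"; simp add: params_def)+
  then show ?thesis
    unfolding kernel_regression [OF p j a] kernel_regression [OF p' j a] T R * by simp
qed

text \<open>After the covariances given K are split by \<open>kernel_insert\<close>, the terms
  quadratic in g cancel and a factor \<sigma> divides out; what remains is linear in g and in
  \<sigma>.\<close>

lemma kernel_dominated:
  assumes p: "params L w" and j: "j < n" "j \<notin> K"
    and i: "i < n" "i \<notin> K" "i \<noteq> j" and l: "l < n" "l \<notin> K" "l \<noteq> j"
    and dom: "(kernel L w K i l)\<^sup>2 * kernel L w K j j \<le> (kernel L w K i j)\<^sup>2 * kernel L w K l l"
  defines "T \<equiv> kernel L w (insert j K)" and "\<sigma> \<equiv> kernel L w K j j"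
    and "f \<equiv> kernel L w K i j / kernel L w K j j" and "g \<equiv> kernel L w K l j / kernel L w K j j"
  shows "(T i l)\<^sup>2 + 2 * T i l * f * g * \<sigma> \<le> f\<^sup>2 * \<sigma> * T l l"
    and "kernel L w K i l = T i l + f * g * \<sigma>" and "\<sigma> > 0"
proof -
  show pos: "\<sigma> > 0" unfolding \<sigma>_def by (rule kernel_diag_pos [OF p j])
  have jl: "kernel L w K j l = g * \<sigma>"
    using pos kernel_symmetric [OF p j l(1,2)] by (simp add: g_def \<sigma>_def)
  show il: "kernel L w K i l = T i l + f * g * \<sigma>"
    using kernel_insert [OF p j i, of l] jl by (simp add: T_def f_def)
  have ll: "kernel L w K l l = T l l + g * g * \<sigma>"
    using kernel_insert [OF p j l, of l] jl by (simp add: T_def g_def)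
  have ij: "kernel L w K i j = f * \<sigma>" using pos by (simp add: f_def \<sigma>_def)
  have "(T i l + f * g * \<sigma>)\<^sup>2 * \<sigma> \<le> (f * \<sigma>)\<^sup>2 * (T l l + g * g * \<sigma>)"
    using dom unfolding il ll ij \<sigma>_def [symmetric] .
  then have "\<sigma> * ((T i l)\<^sup>2 + 2 * T i l * f * g * \<sigma>) \<le> \<sigma> * (f\<^sup>2 * \<sigma> * T l l)"
    by (simp add: power2_eq_square algebra_simps)
  then show "(T i l)\<^sup>2 + 2 * T i l * f * g * \<sigma> \<le> f\<^sup>2 * \<sigma> * T l l"
    using pos by simp
qed

text \<open>The edges out of j do not affect conditional covariances given j, and act linearly on the
  regression coefficients f, g of i and l on j. If some child of j were relevant to i, these edges
  could be tuned to make f vanish; if some child were relevant to l, they could be tuned to give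
  g any value. Either contradicts domination. Hence f and g do not depend on these edges, and
  domination bounds the reciprocal of the conditional variance of j, which therefore does not depend
  on them either. So all edges at j can be deleted without changing the covariance of i and l.\<close>

lemma kernel_zero_of_dominated:
  assumes j: "j < n" "j \<notin> K"
    and i: "i < n" "i \<notin> K" "i \<noteq> j" and l: "l < n" "l \<notin> K" "l \<noteq> j"
    and dom: "\<And>L w. params L w \<Longrightarrow>
      (kernel L w K i l)\<^sup>2 * kernel L w K j j \<le> (kernel L w K i j)\<^sup>2 * kernel L w K l l"
    and p: "params L w" and nz: "kernel L w (insert j K) i l \<noteq> 0"
  shows "kernel L w K i l = 0"
proof -
  define T where "T = kernel L w (insert j K)"
  define f where "f L' = kernel L' w K i j / kernel L' w K j j" for L'
  define g where "g L' = kernel L' w K l j / kernel L' w K j j" for L'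
  have i': "i < n" "i \<notin> insert j K" and l': "l < n" "l \<notin> insert j K" using i l by auto
  have ineq: "(T i l)\<^sup>2 + 2 * T i l * f L' * g L' * kernel L' w K j j
      \<le> (f L')\<^sup>2 * kernel L' w K j j * T l l" "kernel L' w K j j > 0"
      "kernel L' w K i l = T i l + f L' * g L' * kernel L' w K j j"
    if p': "params L' w" and eq: "\<And>u v. u \<noteq> j \<Longrightarrow> L' u v = L u v" for L'
    using kernel_dominated [OF p' j i l dom [OF p']]
      kernel_row_irrelevant [OF p p' i' eq] kernel_row_irrelevant [OF p p' l' eq]
    by (simp_all add: T_def f_def g_def)
  have T0: "(T i l)\<^sup>2 > 0" using nz by (simp add: T_def)
  have f0: "f L' \<noteq> 0" if "params L' w" "\<And>u v. u \<noteq> j \<Longrightarrow> L' u v = L u v" for L'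
    using ineq(1) [OF that] T0 by auto
  define shift where "shift c h = L(j := (L j)(c := L j c + h))" for c h
  have shift: "params (shift c h) w" "\<And>u v. u \<noteq> j \<Longrightarrow> shift c h u v = L u v"
    "f (shift c h) = f L + h * w c * res L c (T i)"
    "g (shift c h) = g L + h * w c * res L c (T l)" if "(j, c) \<in> E" for c h
    using p that regression_shift [OF p j i that] regression_shift [OF p j l that]
    by (auto simp: params_def shift_def f_def g_def T_def)
  have w: "w v > 0" for v using p by (simp add: params_def)
  have irr_i: "res L c (T i) = 0" if c: "(j, c) \<in> E" for c
  proof (rule ccontr)
    assume "res L c (T i) \<noteq> 0"
    then have "f (shift c (- f L / (w c * res L c (T i)))) = 0"
      using shift(3) [OF c] w [of c] by (simp add: field_simps)
    then show False using f0 [OF shift(1,2) [OF c]] by blast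
  qed
  have irr_l: "res L c (T l) = 0" if c: "(j, c) \<in> E" for c
  proof (rule ccontr)
    assume r: "res L c (T l) \<noteq> 0"
    \<comment> \<open>This h moves g to f T(l,l) / (2 T(i,l)), where the two terms containing the
      variance of j balance and domination would leave T(i,l)^2 <= 0.\<close>
    define h where "h = (f L * T l l / (2 * T i l) - g L) / (w c * res L c (T l))"
    have "g (shift c h) = f L * T l l / (2 * T i l)"
      using shift(4) [OF c] w [of c] r by (simp add: h_def)
    moreover have "f (shift c h) = f L" using shift(3) [OF c] irr_i [OF c] by simp
    ultimately have "2 * T i l * f (shift c h) * g (shift c h) = (f (shift c h))\<^sup>2 * T l l"
      using nz by (simp add: T_def power2_eq_square)
    then have "2 * T i l * f (shift c h) * g (shift c h) * kernel (shift c h) w K j j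
        = (f (shift c h))\<^sup>2 * kernel (shift c h) w K j j * T l l"
      by (simp add: mult.assoc mult.left_commute mult.commute)
    then show False using ineq(1) [of "shift c h", OF shift(1,2) [OF c]] T0 by linarith
  qed
  have fg: "f L' = f L" "g L' = g L"
    if p': "params L' w" and eq: "\<And>u v. u \<noteq> j \<Longrightarrow> L' u v = L u v" for L'
    unfolding f_def g_def
    using regression_no_children [OF p j i p' eq] regression_no_children [OF p j l p' eq] irr_i irr_l
    by (simp_all add: T_def)
  \<comment> \<open>With f and g constant, domination says that T(i,l)^2 is at most M times the
    variance of j, which bounds the reciprocal of that variance.\<close>
  define M where "M = (f L)\<^sup>2 * T l l - 2 * T i l * f L * g L"
  have "1 / kernel (L(j := (\<lambda>v. h * L j v))) w K j j \<le> M / (T i l)\<^sup>2" for h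
  proof -
    define L' where "L' = L(j := (\<lambda>v. h * L j v))"
    have p': "params L' w" using p by (auto simp: params_def L'_def)
    have eq: "L' u v = L u v" if "u \<noteq> j" for u v using that by (simp add: L'_def)
    have "(T i l)\<^sup>2 \<le> M * kernel L' w K j j"
      using ineq(1) [OF p' eq] fg [OF p' eq] by (simp add: M_def algebra_simps)
    then show ?thesis unfolding L'_def [symmetric] using T0 ineq(2) [OF p' eq] by (simp add: field_simps)
  qed
  then have "kernel (drop_out L j) w K j j = kernel L w K j j"
    by (rule kernel_drop_out_of_bounded [OF p j])
  moreover have p0: "params (drop_out L j) w" by (rule params_drop_out [OF p])
  moreover have eq0: "\<And>u v. u \<noteq> j \<Longrightarrow> drop_out L j u v = L u v" by (simp add: drop_out_def)
  ultimately have "kernel L w K i l = kernel (drop_out L j) w K i l"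
    using ineq(3) [OF p] ineq(3) [OF p0 eq0] fg [OF p0 eq0] by simp
  also have "\<dots> = 0"
  proof -
    \<comment> \<open>With j isolated the covariance of i and j is 0, and domination leaves no room
      for a nonzero covariance of i and l.\<close>
    let ?L = "drop_in (drop_out L j) j"
    have p1: "params ?L w" by (rule params_drop_in [OF p0])
    have "kernel ?L w K i j = 0" "kernel ?L w K i l = kernel (drop_out L j) w K i l"
      using kernel_isolate [OF p j i] l by simp_all
    then have "(kernel (drop_out L j) w K i l)\<^sup>2 * kernel ?L w K j j \<le> 0"
      using dom [OF p1] by simp
    then show ?thesis using kernel_diag_pos [OF p1 j] by (simp add: mult_le_0_iff)
  qed
  finally show ?thesis .
qed

text \<open>Faithfulness gives one point for each conditioning set; \<open>kernel_generic\<close>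
  merges them into a single point that contradicts \<open>kernel_zero_of_dominated\<close>.\<close>

lemma exists_not_dominated:
  assumes j: "j < n" "j \<notin> K"
    and i: "i < n" "i \<notin> K" "i \<noteq> j" and l: "l < n" "l \<notin> K" "l \<noteq> j"
    and "conn K i l h" "conn (insert j K) i l h'"
  shows "\<exists>L w. params L w \<and>
    (kernel L w K i j)\<^sup>2 * kernel L w K l l < (kernel L w K i l)\<^sup>2 * kernel L w K j j"
proof (rule ccontr)
  assume "\<not> ?thesis"
  then have dom: "(kernel L w K i l)\<^sup>2 * kernel L w K j j \<le> (kernel L w K i j)\<^sup>2 * kernel L w K l l"
    if "params L w" for L w
    using that by (meson not_less)
  obtain L1 w1 where 1: "params L1 w1" "kernel L1 w1 K i l \<noteq> 0"
    using conn_kernel_nonzero [OF \<open>conn K i l h\<close>] i l by auto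
  obtain L2 w2 where 2: "params L2 w2" "kernel L2 w2 (insert j K) i l \<noteq> 0"
    using conn_kernel_nonzero [OF \<open>conn (insert j K) i l h'\<close>] i l by auto
  obtain L w where "params L w" "kernel L w K i l \<noteq> 0" "kernel L w (insert j K) i l \<noteq> 0"
    using kernel_generic [OF 1(1) i(1,2) l(1) 2(1) i(1) _ l(1) 1(2) 2(2)] i by auto
  then show False using kernel_zero_of_dominated [OF j i l dom] by blast
qed

section \<open>The Gaussian model\<close>

text \<open>The inverse of the precision matrix: with nothing conditioned on, the kernels are its
  columns, which explains the order of the arguments.\<close>

definition cov_of :: "(nat \<Rightarrow> nat \<Rightarrow> real) \<Rightarrow> (nat \<Rightarrow> real) \<Rightarrow> real mat" where
  "cov_of L w = mat n n (\<lambda>(x, y). kernel L w {} y x)"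

text \<open>With N = I - \<Lambda>, the matrix product S satisfies N^T S = \<Omega> N^(-1). Thus the
  weighted residuals of column y of S form column y of N^(-1), and the reproducing identity reduces
  to N N^(-1) = I.\<close>

lemma model_matrix:
  assumes p: "params L w"
  defines "\<Lambda> \<equiv> mat n n (\<lambda>(u, v). L u v)" and "\<Omega> \<equiv> mat n n (\<lambda>(u, v). if u = v then 1 / w u else 0)"
  shows "transpose_mat (mat_inv (1\<^sub>m n - \<Lambda>)) * \<Omega> * mat_inv (1\<^sub>m n - \<Lambda>) = cov_of L w"
proof -
  define N where "N = 1\<^sub>m n - \<Lambda>"
  have N: "N \<in> carrier_mat n n" unfolding N_def \<Lambda>_def by (rule minus_carrier_mat) simp
  have N_index: "N $$ (u, v) = (if u = v then 1 else 0) - L u v" if "u < n" "v < n" for u v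
    using that by (simp add: N_def \<Lambda>_def)
  have res_N: "res L v t = (\<Sum>u<n. N $$ (u, v) * t u)" if "v < n" for v t
  proof -
    have "(\<Sum>u<n. N $$ (u, v) * t u) = (\<Sum>u<n. (if u = v then t u else 0) - L u v * t u)"
      using that by (intro sum.cong) (auto simp: N_index algebra_simps)
    then show ?thesis using that by (simp add: res_def sum_subtractf)
  qed
  \<comment> \<open>The transpose of N computes residuals, so its injectivity is
    \<open>res_all_zero\<close> for the empty set.\<close>
  have "det (transpose_mat N) \<noteq> 0"
  proof
    assume "det (transpose_mat N) = 0"
    then obtain v where v: "v \<in> carrier_vec n" "v \<noteq> 0\<^sub>v n" "transpose_mat N *\<^sub>v v = 0\<^sub>v n"
      using det_0_iff_vec_prod_zero [of "transpose_mat N" n] N by auto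
    define t where "t x = (if x < n then v $ x else 0)" for x
    have "res L x t = 0" if "x < n" for x
    proof -
      have "(transpose_mat N *\<^sub>v v) $ x = (\<Sum>u<n. N $$ (u, x) * t u)"
        using that v(1) N by (auto simp: mult_mat_vec_def scalar_prod_def t_def atLeast0LessThan intro!: sum.cong)
      then show ?thesis using v(3) that by (simp add: res_N)
    qed
    moreover have "t \<in> vanishing {}" by (simp add: t_def vanishing_def)
    ultimately have "t = (\<lambda>x. 0)" using res_all_zero [OF p] by blast
    then have "v = 0\<^sub>v n" using v(1) by (intro eq_vecI) (auto simp: t_def fun_eq_iff split: if_splits)
    then show False using v(2) by simp
  qed
  then have "det N \<noteq> 0" by (simp add: det_transpose [OF N])
  note inv = mat_inv_of_det [OF N this]
  define I where "I = mat_inv N"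
  define S where "S = transpose_mat I * \<Omega> * I"
  have I: "I \<in> carrier_mat n n" and \<Omega>: "\<Omega> \<in> carrier_mat n n"
    using inv by (simp_all add: I_def \<Omega>_def)
  then have S: "S \<in> carrier_mat n n" by (simp add: S_def)
  have "transpose_mat N * S = transpose_mat N * transpose_mat I * (\<Omega> * I)"
    using N I \<Omega> by (simp add: S_def assoc_mult_mat [of _ n n _ n _ n])
  also have "transpose_mat N * transpose_mat I = 1\<^sub>m n"
    using inv(3) N I transpose_mult [OF I N] by (simp add: I_def)
  finally have NS: "transpose_mat N * S = \<Omega> * I" using I \<Omega> by simp
  have "kernel L w {} y x = S $$ (x, y)" if y: "y < n" and x: "x < n" for x y
  proof -
    define s where "s x = (if x < n then S $$ (x, y) else 0)" for x
    have res_s: "w v * res L v s = I $$ (v, y)" if v: "v < n" for v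
    proof -
      have "res L v s = (transpose_mat N * S) $$ (v, y)"
      proof -
        have "(transpose_mat N * S) $$ (v, y) = (\<Sum>u<n. transpose_mat N $$ (v, u) * S $$ (u, y))"
          by (rule mult_mat_index) (use N S v y in auto)
        also have "\<dots> = res L v s"
          unfolding res_N [OF v] using N v by (intro sum.cong) (auto simp: s_def)
        finally show ?thesis by simp
      qed
      also have "\<dots> = (\<Sum>u<n. if u = v then 1 / w v * I $$ (v, y) else 0)"
        unfolding NS mult_mat_index [OF \<Omega> I v y] using v by (intro sum.cong) (auto simp: \<Omega>_def)
      finally have "res L v s = 1 / w v * I $$ (v, y)" using v by simp
      moreover have "w v > 0" using p by (simp add: params_def)
      ultimately show ?thesis by simp
    qed
    have "energy L w t s = t y" if t: "t \<in> vanishing {}" for t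
    proof -
      have "energy L w t s = (\<Sum>v<n. res L v t * (w v * res L v s))"
        by (simp add: energy_def mult.assoc mult.left_commute)
      also have "\<dots> = (\<Sum>v<n. \<Sum>u<n. t u * (N $$ (u, v) * I $$ (v, y)))"
      proof (intro sum.cong refl)
        fix v assume "v \<in> {..<n}"
        then have "res L v t * (w v * res L v s) = (\<Sum>u<n. N $$ (u, v) * t u) * I $$ (v, y)"
          using res_s res_N [of v t] by simp
        then show "res L v t * (w v * res L v s) = (\<Sum>u<n. t u * (N $$ (u, v) * I $$ (v, y)))"
          unfolding sum_distrib_right by (simp add: mult_ac)
      qed
      also have "\<dots> = (\<Sum>u<n. t u * (N * I) $$ (u, y))"
        using y by (subst sum.swap) (simp add: mult_mat_index [OF N I] sum_distrib_left)
      also have "\<dots> = (\<Sum>u<n. if u = y then t u else 0)"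
        using inv(2) y by (intro sum.cong) (auto simp: I_def)
      finally show ?thesis using y by simp
    qed
    then have "is_kernel L w {} y s" by (simp add: is_kernel_def vanishing_def s_def)
    then show ?thesis using x kernel_eqI [OF p] by (simp add: s_def)
  qed
  then have "S = cov_of L w" using S by (intro eq_matI) (auto simp: cov_of_def)
  then show ?thesis by (simp add: S_def I_def N_def)
qed

lemma gauss_dag_model_eq: "gauss_dag_model n E = {cov_of L w | L w. params L w}"
proof (intro equalityI subsetI)
  fix S assume "S \<in> gauss_dag_model n E"
  then obtain \<Lambda> \<Omega> where S: "S = transpose_mat (mat_inv (1\<^sub>m n - \<Lambda>)) * \<Omega> * mat_inv (1\<^sub>m n - \<Lambda>)"
    and \<Lambda>: "\<Lambda> \<in> carrier_mat n n" "\<And>u v. u < n \<Longrightarrow> v < n \<Longrightarrow> (u, v) \<notin> E \<Longrightarrow> \<Lambda> $$ (u, v) = 0"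
    and \<Omega>: "\<Omega> \<in> carrier_mat n n" "diagonal_mat \<Omega>" "\<And>u. u < n \<Longrightarrow> \<Omega> $$ (u, u) > 0"
    unfolding gauss_dag_model_def by blast
  \<comment> \<open>\<open>params\<close> constrains all natural numbers: beyond n the coefficients
    are set to 0 and the weights to 1.\<close>
  define L where "L u v = (if u < n \<and> v < n then \<Lambda> $$ (u, v) else 0)" for u v
  define w where "w v = (if v < n then 1 / \<Omega> $$ (v, v) else 1)" for v
  have p: "params L w" using \<Lambda>(2) \<Omega>(3) by (auto simp: params_def L_def w_def)
  have "\<Lambda> = mat n n (\<lambda>(u, v). L u v)" using \<Lambda>(1) by (auto simp: L_def)
  moreover have "\<Omega> = mat n n (\<lambda>(u, v). if u = v then 1 / w u else 0)"
    using \<Omega> by (auto simp: w_def diagonal_mat_def)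
  ultimately have "S = cov_of L w" using S model_matrix [OF p] by simp
  then show "S \<in> {cov_of L w | L w. params L w}" using p by blast
next
  fix S assume "S \<in> {cov_of L w | L w. params L w}"
  then obtain L w where S: "S = cov_of L w" and p: "params L w" by blast
  let ?\<Lambda> = "mat n n (\<lambda>(u, v). L u v)" and ?\<Omega> = "mat n n (\<lambda>(u, v). if u = v then 1 / w u else 0)"
  have "S = transpose_mat (mat_inv (1\<^sub>m n - ?\<Lambda>)) * ?\<Omega> * mat_inv (1\<^sub>m n - ?\<Lambda>)"
    using S model_matrix [OF p] by simp
  moreover have "\<forall>u<n. \<forall>v<n. (u, v) \<notin> E \<longrightarrow> ?\<Lambda> $$ (u, v) = 0" "\<forall>u<n. ?\<Omega> $$ (u, u) > 0"
    "diagonal_mat ?\<Omega>"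
    using p by (auto simp: params_def diagonal_mat_def)
  moreover have "?\<Lambda> \<in> carrier_mat n n" "?\<Omega> \<in> carrier_mat n n" by simp_all
  ultimately show "S \<in> gauss_dag_model n E" unfolding gauss_dag_model_def by blast
qed

lemma cov_of_index: "x < n \<Longrightarrow> y < n \<Longrightarrow> cov_of L w $$ (x, y) = kernel L w {} y x"
  by (simp add: cov_of_def)

text \<open>The combination represents the functional sending t to the sum of z c * t c, and unit
  functions recover the coefficients. This yields both positive definiteness of the covariance
  matrix and injectivity of its block at C.\<close>

lemma kernel_combination:
  fixes z :: "nat \<Rightarrow> real"
  assumes p: "params L w" and C: "C \<subseteq> {..<n}"
  defines "s \<equiv> (\<lambda>x. \<Sum>c\<in>C. z c * kernel L w {} c x)"
  shows "s \<in> vanishing {}"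
    and "t \<in> vanishing {} \<Longrightarrow> energy L w s t = (\<Sum>c\<in>C. z c * t c)"
    and "energy L w s s = 0 \<Longrightarrow> c \<in> C \<Longrightarrow> z c = 0"
proof -
  have fin: "finite C" using C finite_subset by blast
  have ker: "kernel L w {} c \<in> vanishing {}" "t \<in> vanishing {} \<Longrightarrow> energy L w (kernel L w {} c) t = t c"
    if "c \<in> C" for c t
    using kernel_vanishing [OF p, of c "{}"] kernel_reproducing [OF p, of c "{}" t] that C
    by (auto simp: energy_commute)
  show vs: "s \<in> vanishing {}" using ker(1) by (simp add: s_def vanishing_def)
  show *: "energy L w s t = (\<Sum>c\<in>C. z c * t c)" if "t \<in> vanishing {}" for t
    unfolding s_def energy_sum [OF fin] using ker(2) [OF _ that] by simp
  assume "energy L w s s = 0" and c: "c \<in> C"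
  then have "s = (\<lambda>x. 0)" using energy_definite [OF p vs] by simp
  moreover have "unit_fun c \<in> vanishing {}" using c C by (intro unit_fun_vanishing) auto
  ultimately have "(\<Sum>c'\<in>C. z c' * unit_fun c c') = 0"
    using *[of "unit_fun c"] by (simp add: energy_def)
  then show "z c = 0" using c fin by (simp add: if_distrib [of "\<lambda>x. _ * x"] cong: if_cong)
qed

lemma cov_mat_cov_of:
  assumes p: "params L w"
  shows "cov_mat n (cov_of L w)"
  unfolding cov_mat_def
proof (intro conjI ballI impI)
  show "cov_of L w \<in> carrier_mat n n" by (simp add: cov_of_def)
  show "transpose_mat (cov_of L w) = cov_of L w"
    by (rule eq_matI) (auto simp: cov_of_def intro: kernel_symmetric [OF p])
  fix v :: "real vec" assume v: "v \<in> carrier_vec n" "v \<noteq> 0\<^sub>v n"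
  define s where "s x = (\<Sum>c<n. v $ c * kernel L w {} c x)" for x
  have s_eq: "s = (\<lambda>x. \<Sum>c<n. v $ c * kernel L w {} c x)" by (simp add: s_def fun_eq_iff)
  note comb = kernel_combination [OF p subset_refl, where z = "\<lambda>c. v $ c", folded s_eq]
  have "(cov_of L w *\<^sub>v v) $ x = s x" if "x < n" for x
    using that v(1) by (simp add: cov_of_def mult_mat_vec_def scalar_prod_def s_def atLeast0LessThan mult.commute)
  then have "v \<bullet> (cov_of L w *\<^sub>v v) = (\<Sum>x<n. v $ x * s x)"
    using v(1) by (simp add: scalar_prod_def atLeast0LessThan cov_of_def)
  then have "v \<bullet> (cov_of L w *\<^sub>v v) = energy L w s s" using comb(2) [OF comb(1)] by simp
  moreover have "energy L w s s \<noteq> 0"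
  proof
    assume "energy L w s s = 0"
    then have "v $ c = 0" if "c < n" for c using comb(3) [of c] that by simp
    then have "v = 0\<^sub>v n" using v(1) by (intro eq_vecI) auto
    then show False using v(2) by simp
  qed
  ultimately show "v \<bullet> (cov_of L w *\<^sub>v v) > 0" using energy_nonneg [OF p, of s] by simp
qed

text \<open>The vector z solving the normal equations consists of the Lagrange multipliers of the constraint that
  the kernel vanish on C.\<close>

lemma cond_cov_cov_of:
  assumes p: "params L w" and C: "C \<subseteq> {..<n}" and a: "a < n" and b: "b < n" "b \<notin> C"
  shows "cond_cov (cov_of L w) a b C = kernel L w C b a"
proof -
  let ?t = "kernel L w C b"
  define z where "z c = - energy L w (unit_fun c) ?t" for c
  have vt: "?t \<in> vanishing C" by (rule kernel_vanishing [OF p b])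
  have vt0: "?t \<in> vanishing {}" by (rule vanishing_mono [OF _ vt]) simp
  have fin: "finite C" using C finite_subset by blast
  have t: "?t y = kernel L w {} b y - (\<Sum>c\<in>C. kernel L w {} c y * z c)" if y: "y < n" for y
  proof -
    have vy: "kernel L w {} y \<in> vanishing {}" using kernel_vanishing [OF p y] by simp
    have "?t y = energy L w (kernel L w {} y) ?t"
      using kernel_reproducing [OF p y _ vt0] by (simp add: energy_commute)
    also have "\<dots> = (\<Sum>x<n. kernel L w {} y x * energy L w (unit_fun x) ?t)"
      by (rule energy_expansion [OF vy])
    \<comment> \<open>Off C the reproducing identity gives 1 at b and 0 elsewhere; on C the energy
      is minus the multiplier z.\<close>
    also have "\<dots> = (\<Sum>x<n. (if x = b then kernel L w {} y x else 0) - (if x \<in> C then kernel L w {} y x * z x else 0))"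
    proof (intro sum.cong refl)
      fix x assume "x \<in> {..<n}"
      then have "energy L w (unit_fun x) ?t = (if x = b then 1 else 0)" if "x \<notin> C"
        using kernel_reproducing [OF p b unit_fun_vanishing] that by auto
      then show "kernel L w {} y x * energy L w (unit_fun x) ?t
        = (if x = b then kernel L w {} y x else 0) - (if x \<in> C then kernel L w {} y x * z x else 0)"
        using b by (auto simp: z_def)
    qed
    also have "\<dots> = kernel L w {} y b - (\<Sum>x\<in>C. kernel L w {} y x * z x)"
    proof -
      have "(\<Sum>x<n. if x \<in> C then kernel L w {} y x * z x else 0) = (\<Sum>x\<in>{..<n} \<inter> C. kernel L w {} y x * z x)"
        by (rule sum.inter_restrict [symmetric]) simp
      moreover have "{..<n} \<inter> C = C" using C by auto
      ultimately show ?thesis using b by (simp add: sum_subtractf)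
    qed
    also have "\<dots> = kernel L w {} b y - (\<Sum>c\<in>C. kernel L w {} c y * z c)"
    proof -
      have "kernel L w {} y x = kernel L w {} x y" if "x < n" for x
        using kernel_symmetric [OF p y _ that] by simp
      then show ?thesis using b C by (auto intro!: sum.cong)
    qed
    finally show ?thesis .
  qed
  have "cond_cov (cov_of L w) a b C
      = cov_of L w $$ (a, b) - (\<Sum>c\<in>C. cov_of L w $$ (a, c) * z c)"
  proof (rule cond_cov_eq [OF _ C a b(1)])
    show "cov_of L w \<in> carrier_mat n n" by (simp add: cov_of_def)
    show "(\<Sum>c'\<in>C. cov_of L w $$ (c, c') * z c') = cov_of L w $$ (c, b)" if "c \<in> C" for c
    proof -
      have "c < n" "?t c = 0" using that C vt by (auto simp: vanishing_def)
      moreover have "(\<Sum>c'\<in>C. cov_of L w $$ (c, c') * z c') = (\<Sum>c'\<in>C. kernel L w {} c' c * z c')"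
        using C \<open>c < n\<close> by (intro sum.cong) (auto simp: cov_of_index)
      ultimately show ?thesis using t [of c] b by (simp add: cov_of_index)
    qed
    fix y c assume y: "\<And>c. c \<in> C \<Longrightarrow> (\<Sum>c'\<in>C. cov_of L w $$ (c, c') * y c') = 0" and c: "c \<in> C"
    define s where "s x = (\<Sum>c\<in>C. y c * kernel L w {} c x)" for x
    have s_eq: "s = (\<lambda>x. \<Sum>c\<in>C. y c * kernel L w {} c x)" by (simp add: s_def fun_eq_iff)
    note comb = kernel_combination [OF p C, where z = y, folded s_eq]
    have "s c = 0" if "c \<in> C" for c
    proof -
      have "s c = (\<Sum>c'\<in>C. cov_of L w $$ (c, c') * y c')"
        unfolding s_def using C that by (intro sum.cong) (auto simp: cov_of_index subset_eq mult.commute)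
      then show ?thesis using y [OF that] by simp
    qed
    then have "energy L w s s = 0" using comb(2) [OF comb(1)] by simp
    then show "y c = 0" using comb(3) c by blast
  qed
  also have "(\<Sum>c\<in>C. cov_of L w $$ (a, c) * z c) = (\<Sum>c\<in>C. kernel L w {} c a * z c)"
    using C a by (intro sum.cong) (auto simp: cov_of_index)
  finally show ?thesis using t [OF a] a b by (simp add: cov_of_index)
qed

section \<open>Partial correlations\<close>

lemma partial_corr_cov_of:
  assumes p: "params L w" and C: "C \<subseteq> {..<n}" and a: "a < n" "a \<notin> C" and b: "b < n" "b \<notin> C"
  shows "partial_corr (cov_of L w) a b C
    = kernel L w C a b / sqrt (kernel L w C a a * kernel L w C b b)"
  using assms by (simp add: partial_corr_def cond_cov_cov_of kernel_symmetric [OF p a b])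

text \<open>The gap between the two sides is the variance of j times the conditional variance of i
  given j and K, which is positive.\<close>

lemma kernel_cauchy_schwarz:
  assumes p: "params L w" and i: "i < n" "i \<notin> K" and j: "j < n" "j \<notin> K" "i \<noteq> j"
  shows "(kernel L w K i j)\<^sup>2 \<le> kernel L w K i i * kernel L w K j j"
proof -
  have pos: "kernel L w K j j > 0" by (rule kernel_diag_pos [OF p j(1,2)])
  have "kernel L w (insert j K) i i > 0" using kernel_diag_pos [OF p i(1)] i j by simp
  then have "kernel L w K i i \<ge> kernel L w K i j / kernel L w K j j * kernel L w K i j"
    using kernel_insert [OF p j(1,2) i j(3), of i] kernel_symmetric [OF p i j(1,2)] by simp
  then show ?thesis using pos by (simp add: field_simps power2_eq_square)
qed

text \<open>After squaring, the variance of i is a common factor of both denominators and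
  cancels.\<close>

lemma partial_corr_le_iff:
  assumes p: "params L w" and K: "K \<subseteq> {..<n}" and i: "i < n" "i \<notin> K" and j: "j < n" "j \<notin> K"
    and l: "l < n" "l \<notin> K"
  shows "\<bar>partial_corr (cov_of L w) i l K\<bar> \<le> \<bar>partial_corr (cov_of L w) i j K\<bar>
    \<longleftrightarrow> (kernel L w K i l)\<^sup>2 * kernel L w K j j \<le> (kernel L w K i j)\<^sup>2 * kernel L w K l l"
proof -
  have pos: "kernel L w K i i > 0" "kernel L w K j j > 0" "kernel L w K l l > 0"
    using kernel_diag_pos [OF p] i j l by simp_all
  have sq: "\<bar>x / sqrt (s * u)\<bar> \<le> \<bar>y / sqrt (s * v)\<bar> \<longleftrightarrow> x\<^sup>2 * v \<le> y\<^sup>2 * u"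
    if "s > 0" "u > 0" "v > 0" for x y s u v :: real
  proof -
    have "\<bar>x / sqrt (s * u)\<bar> \<le> \<bar>y / sqrt (s * v)\<bar> \<longleftrightarrow> x\<^sup>2 / (s * u) \<le> y\<^sup>2 / (s * v)"
      unfolding abs_le_square_iff using that by (simp add: power_divide)
    also have "\<dots> \<longleftrightarrow> x\<^sup>2 * v \<le> y\<^sup>2 * u" using that by (simp add: field_simps)
    finally show ?thesis .
  qed
  show ?thesis
    unfolding partial_corr_cov_of [OF p K i j] partial_corr_cov_of [OF p K i l]
    by (rule sq [OF pos(1,3,2)])
qed

end

theorem theorem6p1:
  fixes n :: nat and E :: "(nat \<times> nat) set" and i j l :: nat and K :: "nat set"
  assumes "dag n E"
    and "i < n" and "j < n" and "l < n" and "K \<subseteq> {..<n}"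
    and "i \<notin> K" and "j \<notin> K" and "l \<notin> K"
    and "i \<noteq> j" and "i \<noteq> l" and "j \<noteq> l"
    and "\<not> d_separates E K i j"
    and "\<not> d_separates E K i l"
  shows "(\<forall>\<delta>\<in>{0..1}. gauss_dag_model n E \<inter> approx_ci_model n \<delta> i j K
              \<subseteq> approx_ci_model n \<delta> i l K)
         \<longleftrightarrow> d_separates E (insert j K) i l"
proof -
  interpret finite_dag n E using assms(1) by unfold_locales
  have i: "i < n" "i \<notin> K" and j: "j < n" "j \<notin> K" and l: "l < n" "l \<notin> K" using assms by auto
  have il: "i \<notin> insert j K" "l \<notin> insert j K" using assms by auto
  obtain h where h: "conn K i l h" using assms d_separates_iff [OF i(2)] by blast
  show ?thesis
  proof
    assume incl: "\<forall>\<delta>\<in>{0..1}. gauss_dag_model n E \<inter> approx_ci_model n \<delta> i j K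
              \<subseteq> approx_ci_model n \<delta> i l K"
    have dom: "(kernel L w K i l)\<^sup>2 * kernel L w K j j \<le> (kernel L w K i j)\<^sup>2 * kernel L w K l l"
      if p: "params L w" for L w
    proof -
      let ?S = "cov_of L w"
      \<comment> \<open>The smallest tolerance whose model contains this matrix; Cauchy-Schwarz
        places it in the unit interval.\<close>
      let ?\<delta> = "\<bar>partial_corr ?S i j K\<bar>"
      have pos: "kernel L w K i i > 0" "kernel L w K j j > 0"
        using kernel_diag_pos [OF p] i j by simp_all
      have "\<bar>kernel L w K i j\<bar> \<le> sqrt (kernel L w K i i * kernel L w K j j)"
        using kernel_cauchy_schwarz [OF p i j assms(9)] by (metis real_sqrt_abs real_sqrt_le_iff)
      then have "?\<delta> \<in> {0..1}"
        using pos by (simp add: partial_corr_cov_of [OF p assms(5) i j] divide_le_eq_1_pos)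
      moreover have "?S \<in> gauss_dag_model n E" using p gauss_dag_model_eq by blast
      moreover have "?S \<in> approx_ci_model n ?\<delta> i j K"
        using cov_mat_cov_of [OF p] by (simp add: approx_ci_model_def)
      ultimately have "?S \<in> approx_ci_model n ?\<delta> i l K" using incl by blast
      then show ?thesis
        using partial_corr_le_iff [OF p assms(5) i j l] by (simp add: approx_ci_model_def)
    qed
    show "d_separates E (insert j K) i l"
    proof (rule ccontr)
      assume "\<not> d_separates E (insert j K) i l"
      then obtain h' where "conn (insert j K) i l h'" using d_separates_iff [OF il(1)] by blast
      then show False
        using exists_not_dominated [OF j i assms(9) l _ h] assms(11) dom by (metis not_less)
    qed
  next
    assume sep: "d_separates E (insert j K) i l"
    show "\<forall>\<delta>\<in>{0..1}. gauss_dag_model n E \<inter> approx_ci_model n \<delta> i j K \<subseteq> approx_ci_model n \<delta> i l K"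
    proof (intro ballI subsetI)
      fix \<delta> :: real and S assume S: "S \<in> gauss_dag_model n E \<inter> approx_ci_model n \<delta> i j K"
      then obtain L w where S_eq: "S = cov_of L w" and p: "params L w"
        using gauss_dag_model_eq by blast
      have pos: "kernel L w K j j > 0" "kernel L w (insert j K) l l > 0"
        using kernel_diag_pos [OF p] j l il by simp_all
      have "kernel L w (insert j K) i l = 0"
        using kernel_markov [OF p i(1) il(1) l(1) il(2)] sep d_separates_iff [OF il(1)] by blast
      then have il_eq: "kernel L w K i l = kernel L w K i j * kernel L w K l j / kernel L w K j j"
        using kernel_insert [OF p j i assms(9), of l] kernel_symmetric [OF p j l] by simp
      \<comment> \<open>The variance of l exceeds the part explained by j by its conditional
        variance given j and K.\<close>
      have "kernel L w K l l \<ge> kernel L w K l j * kernel L w K l j / kernel L w K j j"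
        using kernel_insert [OF p j l, of l] assms(11) kernel_symmetric [OF p j l] pos(2) by simp
      then have "(kernel L w K i j)\<^sup>2 * (kernel L w K l j * kernel L w K l j / kernel L w K j j)
          \<le> (kernel L w K i j)\<^sup>2 * kernel L w K l l"
        by (rule mult_left_mono) simp
      moreover have "(kernel L w K i l)\<^sup>2 * kernel L w K j j
          = (kernel L w K i j)\<^sup>2 * (kernel L w K l j * kernel L w K l j / kernel L w K j j)"
        using pos(1) by (simp add: il_eq power2_eq_square)
      ultimately have "\<bar>partial_corr S i l K\<bar> \<le> \<bar>partial_corr S i j K\<bar>"
        using partial_corr_le_iff [OF p assms(5) i j l] by (simp add: S_eq)
      then show "S \<in> approx_ci_model n \<delta> i l K" using S by (auto simp: approx_ci_model_def)
    qed
  qed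
qed

end
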